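(* Let $(\xi,\zeta)$ be the power series solution, in powers of $\tau$, of the initial value problem $$\xi'=(1+\zeta)\,(2-\chi(\xi,\zeta))^{-1/2},\quad \xi(0)=1,\qquad\qquad \zeta'=\frac{\xi\,(2-\chi(\xi,\zeta))^{-1/2}}{(2-\xi^2)^{3/2}},\quad \zeta(0)=0,$$ where $\chi(\xi,\zeta)=(2-\xi^2)^{-1}\,\big(2\zeta+\zeta^2+(2-\xi^2)^{-1/2}\big)$. The radius of convergence $R$ of $(\xi,\zeta)$ is given by $$R=\int_0^{v_+}g(\sigma)\,d\sigma\approx 0.0839968103939379,$$ where $$g(\sigma)=\frac{2}{(\sigma^2+2\sigma+2)^2}\sqrt{-\frac{3\sigma^6+18\sigma^5+50\sigma^4+80\sigma^3+76\sigma^2+40\sigma-8}{\sigma^4+4\sigma^3+8\sigma^2+8\sigma+2}}$$ and $$v_+=-1+\frac{\sqrt{502+18\sqrt{777}-5\,(251+9\sqrt{777})^{2/3}+8\,\sqrt[3]{251+9\sqrt{777}}}}{3\,\sqrt[3]{251+9\sqrt{777}}}\approx 0.149902575567304 .$$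
   Context: The radius of convergence of the pair $(\xi,\zeta)$ is the radius of convergence of the $\mathbb{R}^2$-valued power series $\tau\mapsto(\xi(\tau),\zeta(\tau))$. *)

theory Defs
  imports "HOL-Analysis.Analysis"
begin

definition chi :: "real \<Rightarrow> real \<Rightarrow> real" where
  "chi x z = (1 / (2 - x\<^sup>2)) * (2 * z + z\<^sup>2 + (2 - x\<^sup>2) powr (-1/2))"

text \<open>
  Local solvability at \<open>\<tau> = 0\<close>. The bases of all real powers equal 1 at the initial point
  \<open>(1, 0)\<close>, hence are positive near \<open>\<tau> = 0\<close>, so no totalized value of \<open>powr\<close> or of
  division matters.
\<close>

definition solves_ivp :: "(real \<Rightarrow> real) \<Rightarrow> (real \<Rightarrow> real) \<Rightarrow> bool" where
  "solves_ivp \<xi> \<zeta> \<longleftrightarrow>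
     \<xi> 0 = 1 \<and> \<zeta> 0 = 0 \<and>
     (\<forall>\<^sub>F \<tau> in nhds 0.
        (\<xi> has_real_derivative
           (1 + \<zeta> \<tau>) * (2 - chi (\<xi> \<tau>) (\<zeta> \<tau>)) powr (-1/2)) (at \<tau>) \<and>
        (\<zeta> has_real_derivative
           \<xi> \<tau> * (2 - chi (\<xi> \<tau>) (\<zeta> \<tau>)) powr (-1/2) / (2 - (\<xi> \<tau>)\<^sup>2) powr (3/2)) (at \<tau>))"

definition power_series :: "(nat \<Rightarrow> real \<times> real) \<Rightarrow> real \<Rightarrow> real \<times> real" where
  "power_series c \<tau> = (\<Sum>n. \<tau> ^ n *\<^sub>R c n)"

text \<open>
  Coefficients of an \<open>\<real>\<^sup>2\<close>-valued power series whose two components solve the initial value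
  problem. The library constant \<^const>\<open>conv_radius\<close> applies to such coefficients directly,
  with the Euclidean norm on \<^typ>\<open>real \<times> real\<close>. Positivity of the radius excludes series
  that diverge off \<open>0\<close>, where \<^const>\<open>suminf\<close> carries no information.
\<close>

definition power_series_solution :: "(nat \<Rightarrow> real \<times> real) \<Rightarrow> bool" where
  "power_series_solution c \<longleftrightarrow>
     conv_radius c > 0 \<and>
     solves_ivp (\<lambda>\<tau>. fst (power_series c \<tau>)) (\<lambda>\<tau>. snd (power_series c \<tau>))"

definition g :: "real \<Rightarrow> real" where
  "g \<sigma> = 2 / (\<sigma>\<^sup>2 + 2 * \<sigma> + 2)\<^sup>2 *
     sqrt (- ((3 * \<sigma>^6 + 18 * \<sigma>^5 + 50 * \<sigma>^4 + 80 * \<sigma>^3 + 76 * \<sigma>\<^sup>2 + 40 * \<sigma> - 8) /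
              (\<sigma>^4 + 4 * \<sigma>^3 + 8 * \<sigma>\<^sup>2 + 8 * \<sigma> + 2)))"

definition v_plus :: real where
  "v_plus = -1 +
     sqrt (502 + 18 * sqrt 777 - 5 * (251 + 9 * sqrt 777) powr (2/3)
             + 8 * root 3 (251 + 9 * sqrt 777)) /
     (3 * root 3 (251 + 9 * sqrt 777))"

end

theory Submission
  imports Defs
begin

text \<open>
The system has a conserved quantity: \<open>(2 - \<xi>\<^sup>2) powr (-1/2) - (1 + \<zeta>)\<^sup>2 / 2\<close> keeps its initial value
\<open>1/2\<close> (\<open>conserved_quantity\<close>). With \<open>Q s = 1 + (1 + s)\<^sup>2\<close> this says \<open>(2 - \<xi>\<^sup>2) powr (-1/2) = Q \<zeta> / 2\<close>, and it
turns \<open>2 - \<chi>\<close> into \<open>(8 - P \<zeta>) / 8\<close>, where \<open>P = 3 Q\<^sup>3 - 4 Q\<^sup>2 - 8\<close> is a polynomial with nonnegative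
coefficients and \<open>P v_plus = 8\<close>. The second equation becomes \<open>\<zeta>' = 1 / g \<zeta>\<close>, so the solution
reaches the value \<open>v\<close> at time \<open>G v\<close>, the integral of \<open>g\<close> over \<open>{0..v}\<close>. The real solution breaks down at
time \<open>G v_plus\<close>, where \<open>2 - \<chi>\<close> vanishes and the derivatives blow up. What has to be explained is why no
complex singularity is closer to the origin.

The reason is positivity. With \<open>e = (2 - \<chi>) powr (-1/2)\<close> as a third unknown the system is polynomial,
\<open>\<xi>' = (1 + \<zeta>) e\<close>, \<open>8 \<zeta>' = \<xi> e (Q \<zeta>)\<^sup>3\<close>, \<open>128 e' = e\<^sup>4 P'(\<zeta>) \<xi> (Q \<zeta>)\<^sup>3\<close>, with nonnegative
coefficients and nonnegative initial values (\<open>polynomial_system\<close>). Hence all Taylor coefficients are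
nonnegative (\<open>polynomial_system_nonneg\<close>), and the partial sums are controlled by Picard iteration: the
derivative of a partial sum is a truncation of the right-hand sides, which is at most the
right-hand sides evaluated at the preceding partial sums, and by induction these are at most the
right-hand sides along the real solution (\<open>partial_sums_le\<close>). So the partial sums are bounded at each
time \<open>G v\<close> with \<open>v < v_plus\<close>, and a nonnegative series with bounded partial sums converges. Conversely, if the
series converged beyond \<open>G v_plus\<close>, then \<open>\<zeta>\<close> would stay below \<open>v_plus\<close> and satisfy \<open>G (\<zeta> \<tau>) = \<tau>\<close> at times that
\<open>G\<close> does not reach (\<open>conv_radius_le_G\<close>).

The closed form of \<open>v_plus\<close> is Cardano's formula for \<open>3 q\<^sup>3 - 4 q\<^sup>2 = 16\<close> in \<open>q = Q v_plus\<close> (\<open>v_plus_root\<close>), and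
its decimals follow from the sign of \<open>P - 8\<close> at two rational points. For the decimals of the
integral, \<open>g\<close> is enclosed between the derivatives of two functions \<open>- (a - q) powr (3/2) * \<Psi> q\<close>, where
\<open>q = Q s\<close>, \<open>a\<close> is a rational number just below or just above \<open>Q v_plus\<close>, and \<open>\<Psi>\<close> is a polynomial of degree
24 (\<open>G_ge_primitive\<close>, \<open>G_le_primitive\<close>). The enclosure is a polynomial inequality on an interval. In a
variable that maps the interval into \<open>[-1, 1]\<close> it holds because the constant coefficient outweighs
all the others together, a comparison of integers.
\<close>

section \<open>Power series and the functions they represent\<close>

text \<open>
The radius \<open>r\<close> is a common lower bound carried along with each representation, so that one
calculus serves twice: with a small \<open>r\<close>, to turn the differential equations near \<open>0\<close> into
identities of formal power series, and with the full radius of convergence, to evaluate these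
identities on the whole interval of convergence.
\<close>

definition represents :: "ereal \<Rightarrow> real fps \<Rightarrow> (real \<Rightarrow> real) \<Rightarrow> bool" where
  "represents r F f \<longleftrightarrow> r \<le> fps_conv_radius F \<and> (\<forall>t. ereal \<bar>t\<bar> < r \<longrightarrow> eval_fps F t = f t)"

lemma represents_eval: "represents r F f \<Longrightarrow> ereal \<bar>t\<bar> < r \<Longrightarrow> eval_fps F t = f t"
  by (simp add: represents_def)

lemma represents_numeral: "represents r (numeral n) (\<lambda>_. numeral n)"
  by (simp add: represents_def)

lemma represents_one: "represents r 1 (\<lambda>_. 1)"
  by (simp add: represents_def)

lemma represents_add:
  assumes "represents r F f" "represents r G h"
  shows "represents r (F + G) (\<lambda>t. f t + h t)"
  using assms fps_conv_radius_add[of F G] unfolding represents_def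
  by (auto simp: eval_fps_add less_le_trans intro: order_trans[rotated])

lemma represents_diff:
  assumes "represents r F f" "represents r G h"
  shows "represents r (F - G) (\<lambda>t. f t - h t)"
  using assms fps_conv_radius_diff[of F G] unfolding represents_def
  by (auto simp: eval_fps_diff less_le_trans intro: order_trans[rotated])

lemma represents_mult:
  assumes "represents r F f" "represents r G h"
  shows "represents r (F * G) (\<lambda>t. f t * h t)"
  using assms fps_conv_radius_mult[of F G] unfolding represents_def
  by (auto simp: eval_fps_mult less_le_trans intro: order_trans[rotated])

lemma represents_power:
  assumes "represents r F f"
  shows "represents r (F ^ n) (\<lambda>t. f t ^ n)"
  using assms fps_conv_radius_power[of F n] unfolding represents_def
  by (auto simp: eval_fps_power less_le_trans intro: order_trans[rotated])

lemmas represents_intros =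
  represents_numeral represents_one represents_add represents_diff represents_mult represents_power

lemma represents_deriv:
  assumes F: "represents r F f" and t: "ereal \<bar>t\<bar> < r"
  shows "(f has_real_derivative eval_fps (fps_deriv F) t) (at t)"
proof (rule has_field_derivative_transform_within_open)
  show "(eval_fps F has_real_derivative eval_fps (fps_deriv F) t) (at t)"
    using assms by (intro has_field_derivative_eval_fps) (auto simp: represents_def less_le_trans)
  show "open (eball 0 r)" "t \<in> eball 0 r" using t by auto
  show "eval_fps F x = f x" if "x \<in> eball 0 r" for x
    using that F by (auto simp: represents_def)
qed

lemma represents_fps_deriv:
  assumes "represents r F f"
  shows "represents r (fps_deriv F) (eval_fps (fps_deriv F))"
  using assms fps_conv_radius_deriv[of F] by (auto simp: represents_def intro: order_trans)

text \<open>
Differentiating keeps the function zero and shifts the coefficients, so the coefficient of order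
\<open>n\<close> becomes the value at \<open>0\<close> after \<open>n\<close> steps.
\<close>

lemma represents_zero_imp_nth_eq_0:
  assumes "0 < r" "represents r F (\<lambda>_. 0)"
  shows "fps_nth F n = 0"
  using assms(2)
proof (induction n arbitrary: F)
  case 0
  then show ?case using assms(1) represents_eval[OF 0, of 0] by (simp add: eval_fps_at_0 zero_ereal_def)
next
  case (Suc n)
  have "represents r (fps_deriv F) (\<lambda>_. 0)"
    unfolding represents_def
  proof (intro conjI allI impI)
    show "r \<le> fps_conv_radius (fps_deriv F)"
      using represents_fps_deriv[OF Suc.prems] by (simp add: represents_def)
    show "eval_fps (fps_deriv F) t = 0" if "ereal \<bar>t\<bar> < r" for t
      using represents_deriv[OF Suc.prems that] DERIV_const by (rule DERIV_unique)
  qed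
  from Suc.IH[OF this] show ?case by simp
qed

lemma represents_unique:
  assumes "0 < r" "represents r F f" "represents r G h" "\<And>t. ereal \<bar>t\<bar> < r \<Longrightarrow> f t = h t"
  shows "F = G"
proof -
  have "represents r (F - G) (\<lambda>_. 0)"
    using represents_diff[OF assms(2,3)] assms(4) by (auto simp: represents_def)
  from represents_zero_imp_nth_eq_0[OF assms(1) this] have "fps_nth (F - G) n = 0" for n .
  then show ?thesis by (simp add: fps_eq_iff)
qed


section \<open>The components of a plane-valued power series\<close>

lemma conv_radius_antimono:
  assumes "\<And>n. norm (f n) \<le> norm (h n)"
  shows "conv_radius h \<le> conv_radius f"
  unfolding conv_radius_altdef
proof (intro Liminf_mono always_eventually allI)
  fix n
  show "inverse (ereal (root n (norm (h n)))) \<le> inverse (ereal (root n (norm (f n))))"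
    using assms[of n]
    by (cases "n = 0") (auto intro!: ereal_inverse_antimono real_root_le_mono simp: real_root_ge_zero)
qed

lemma conv_radius_components:
  fixes c :: "nat \<Rightarrow> real \<times> real"
  shows "conv_radius c \<le> conv_radius (\<lambda>n. fst (c n))" "conv_radius c \<le> conv_radius (\<lambda>n. snd (c n))"
  by (rule conv_radius_antimono, metis norm_fst_le norm_snd_le prod.collapse)+

lemma conv_radius_ge_components:
  fixes c :: "nat \<Rightarrow> real \<times> real"
  assumes "r \<le> conv_radius (\<lambda>n. fst (c n))" "r \<le> conv_radius (\<lambda>n. snd (c n))"
  shows "r \<le> conv_radius c"
proof -
  have "r \<le> min (conv_radius (\<lambda>n. norm (fst (c n)))) (conv_radius (\<lambda>n. norm (snd (c n))))"
    using assms by (simp del: real_norm_def)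
  also have "\<dots> \<le> conv_radius (\<lambda>n. norm (fst (c n)) + norm (snd (c n)))"
    by (rule conv_radius_add_ge)
  also have "\<dots> \<le> conv_radius c"
    by (intro conv_radius_antimono) (simp add: norm_prod_def sqrt_sum_squares_le_sum_abs)
  finally show ?thesis .
qed

lemma sums_Pair_components:
  assumes "(\<lambda>n. fst (c n) * t ^ n) sums a" "(\<lambda>n. snd (c n) * t ^ n) sums b"
  shows "(\<lambda>n. t ^ n *\<^sub>R c n) sums (a, b)"
proof -
  have "(\<Sum>i<n. t ^ i *\<^sub>R c i) = (\<Sum>i<n. fst (c i) * t ^ i, \<Sum>i<n. snd (c i) * t ^ i)" for n
    by (induction n) (simp_all add: prod_eq_iff mult.commute zero_prod_def)
  then show ?thesis
    using tendsto_Pair[OF assms[unfolded sums_def]] by (simp add: sums_def)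
qed

lemma power_series_eq_eval_fps:
  fixes c :: "nat \<Rightarrow> real \<times> real"
  assumes "ereal \<bar>t\<bar> < conv_radius c"
  shows "power_series c t =
    (eval_fps (Abs_fps (\<lambda>n. fst (c n))) t, eval_fps (Abs_fps (\<lambda>n. snd (c n))) t)"
proof -
  have "(\<lambda>n. fst (c n) * t ^ n) sums eval_fps (Abs_fps (\<lambda>n. fst (c n))) t"
    and "(\<lambda>n. snd (c n) * t ^ n) sums eval_fps (Abs_fps (\<lambda>n. snd (c n))) t"
    using sums_eval_fps[of t "Abs_fps (\<lambda>n. fst (c n))"] less_le_trans[OF assms conv_radius_components(1)]
      sums_eval_fps[of t "Abs_fps (\<lambda>n. snd (c n))"] less_le_trans[OF assms conv_radius_components(2)]
    by (simp_all add: fps_conv_radius_def)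
  then have "(\<lambda>n. t ^ n *\<^sub>R c n) sums
    (eval_fps (Abs_fps (\<lambda>n. fst (c n))) t, eval_fps (Abs_fps (\<lambda>n. snd (c n))) t)"
    by (rule sums_Pair_components)
  then show ?thesis by (simp add: power_series_def sums_iff)
qed

section \<open>The conserved quantity\<close>

text \<open>
Both polynomials are evaluated at reals and at formal power series, hence the ring-polymorphic
types. \<open>Q\<close> is the value of \<open>2 (2 - \<xi>\<^sup>2) powr (-1/2)\<close> in terms of \<open>\<zeta>\<close>, and \<open>P\<close> measures how far
\<open>2 - \<chi>\<close> has moved from its initial value: \<open>2 - \<chi> = (8 - P \<zeta>) / 8\<close>. The expanded form of \<open>P\<close> shows
that its coefficients are nonnegative, which its expression through \<open>Q\<close> hides; \<open>P'\<close> is its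
derivative.
\<close>

definition Q :: "'a \<Rightarrow> 'a :: comm_ring_1" where
  "Q s = s\<^sup>2 + 2 * s + 2"

definition P :: "'a \<Rightarrow> 'a :: comm_ring_1" where
  "P s = 3 * s ^ 6 + 18 * s ^ 5 + 50 * s ^ 4 + 80 * s ^ 3 + 76 * s\<^sup>2 + 40 * s"

definition P' :: "'a \<Rightarrow> 'a :: comm_ring_1" where
  "P' s = 18 * s ^ 5 + 90 * s ^ 4 + 200 * s ^ 3 + 240 * s\<^sup>2 + 152 * s + 40"

lemma P_eq_Q: "P s = 3 * Q s ^ 3 - 4 * (Q s)\<^sup>2 - 8" for s :: real
  unfolding P_def Q_def by algebra

lemma Q_eq_square: "Q s = 1 + (1 + s)\<^sup>2"
  unfolding Q_def
  by (simp add: algebra_simps power2_eq_square)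

lemma Q_pos: "0 < Q (s :: real)"
  by (simp add: Q_eq_square add_pos_nonneg)

text \<open>
The conservation law eliminates \<open>\<xi>\<close> from \<open>\<chi>\<close>: as \<open>2 \<zeta> + \<zeta>\<^sup>2 = Q - 2\<close>, it gives
\<open>\<chi> = Q\<^sup>2 / 4 * (Q - 2 + Q / 2)\<close>. This trades the real powers for polynomial relations, which make
sense for formal power series.
\<close>

lemma reduce_powers:
  fixes x s :: real
  assumes x: "0 < 2 - x\<^sup>2" and chi: "0 < 2 - chi x s"
    and conserved: "(2 - x\<^sup>2) powr (-1/2) = Q s / 2"
  defines "e \<equiv> (2 - chi x s) powr (-1/2)"
  shows "(Q s)\<^sup>2 * (2 - x\<^sup>2) = 4" "0 < e" "e\<^sup>2 * (8 - P s) = 8"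
    "x * e / (2 - x\<^sup>2) powr (3/2) = x * e * Q s ^ 3 / 8"
proof -
  have powr2: "(b powr (-1/2))\<^sup>2 * b = 1" if "0 < b" for b :: real
    using that by (simp add: powr_minus_divide powr_half_sqrt power_divide)
  show conserved': "(Q s)\<^sup>2 * (2 - x\<^sup>2) = 4"
    using powr2[OF x] unfolding conserved by (simp add: power_divide)
  show "0 < e" using chi by (simp add: e_def)
  have e2: "e\<^sup>2 * (2 - chi x s) = 1"
    using powr2[OF chi] by (simp add: e_def)
  have q: "2 * s + s\<^sup>2 = Q s - 2" by (simp add: Q_def)
  have "1 / (2 - x\<^sup>2) = (Q s)\<^sup>2 / 4" using conserved' x by (simp add: field_simps)
  then have "chi x s = (Q s)\<^sup>2 / 4 * (Q s - 2 + Q s / 2)"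
    unfolding chi_def conserved q by (simp only:)
  then have chi_eq: "8 * (2 - chi x s) = 8 - P s"
    by (simp add: P_eq_Q field_simps power2_eq_square power3_eq_cube)
  have "e\<^sup>2 * (8 - P s) = 8 * (e\<^sup>2 * (2 - chi x s))"
    unfolding chi_eq[symmetric] by simp
  with e2 show "e\<^sup>2 * (8 - P s) = 8" by simp
  have "1 / (2 - x\<^sup>2) powr (3/2) = (2 - x\<^sup>2) powr (-1/2 + -1/2 + -1/2)"
    by (simp add: powr_minus_divide)
  also have "\<dots> = (Q s / 2) ^ 3"
    unfolding powr_add conserved by (simp add: power3_eq_cube)
  finally have "1 / (2 - x\<^sup>2) powr (3/2) = Q s ^ 3 / 8" by (simp add: power_divide)
  then have "x * e * (1 / (2 - x\<^sup>2) powr (3/2)) = x * e * (Q s ^ 3 / 8)" by (rule arg_cong)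
  then show "x * e / (2 - x\<^sup>2) powr (3/2) = x * e * Q s ^ 3 / 8"
    by simp
qed

text \<open>
On a small interval the bases of all real powers are positive, by continuity from the initial
point, and the interval can be taken inside the disc of convergence.
\<close>

lemma power_series_solution_local:
  fixes c :: "nat \<Rightarrow> real \<times> real"
  assumes "power_series_solution c"
    and x_def: "x = (\<lambda>t. fst (power_series c t))" and z_def: "z = (\<lambda>t. snd (power_series c t))"
  obtains d where "0 < d" "ereal d \<le> conv_radius c"
    "\<And>t. \<bar>t\<bar> < d \<Longrightarrow> 0 < 2 - (x t)\<^sup>2 \<and> 0 < 2 - chi (x t) (z t) \<and> 0 < 1 + z t"
    "\<And>t. \<bar>t\<bar> < d \<Longrightarrow>
      (x has_real_derivative (1 + z t) * (2 - chi (x t) (z t)) powr (-1/2)) (at t)"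
    "\<And>t. \<bar>t\<bar> < d \<Longrightarrow> (z has_real_derivative
      x t * (2 - chi (x t) (z t)) powr (-1/2) / (2 - (x t)\<^sup>2) powr (3/2)) (at t)"
proof -
  define D where "D t \<longleftrightarrow>
    (x has_real_derivative (1 + z t) * (2 - chi (x t) (z t)) powr (-1/2)) (at t) \<and>
    (z has_real_derivative
      x t * (2 - chi (x t) (z t)) powr (-1/2) / (2 - (x t)\<^sup>2) powr (3/2)) (at t)" for t
  have rad: "0 < conv_radius c" and init: "x 0 = 1" "z 0 = 0" and D: "\<forall>\<^sub>F t in nhds 0. D t"
    using assms(1) unfolding power_series_solution_def solves_ivp_def D_def x_def z_def by auto
  have cont: "isCont x 0" "isCont z 0"
    using eventually_nhds_x_imp_x[OF D] by (auto simp: D_def intro: DERIV_isCont)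
  have positive: "\<forall>\<^sub>F t in nhds 0. 0 < f t" if "isCont f 0" "0 < f 0" for f :: "real \<Rightarrow> real"
    using that by (simp add: isCont_def tendsto_at_iff_tendsto_nhds order_tendstoD(1))
  have "isCont (\<lambda>t. 2 - (x t)\<^sup>2) 0" "isCont (\<lambda>t. 2 - chi (x t) (z t)) 0" "isCont (\<lambda>t. 1 + z t) 0"
    unfolding chi_def using cont init by (auto intro!: continuous_intros)
  from this[THEN positive]
  have "\<forall>\<^sub>F t in nhds 0. 0 < 2 - (x t)\<^sup>2" "\<forall>\<^sub>F t in nhds 0. 0 < 2 - chi (x t) (z t)"
    "\<forall>\<^sub>F t in nhds 0. 0 < 1 + z t"
    by (simp_all add: init chi_def)
  moreover have "\<forall>\<^sub>F t in nhds 0. t \<in> eball 0 (conv_radius c)"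
    using rad by (intro eventually_nhds_in_open) (auto simp: zero_ereal_def)
  ultimately have "\<forall>\<^sub>F t in nhds 0. D t \<and> 0 < 2 - (x t)\<^sup>2 \<and> 0 < 2 - chi (x t) (z t) \<and> 0 < 1 + z t
      \<and> ereal \<bar>t\<bar> < conv_radius c"
    using D by eventually_elim auto
  then obtain d where d: "0 < d" "\<And>t. \<bar>t\<bar> < d \<Longrightarrow> D t \<and> 0 < 2 - (x t)\<^sup>2 \<and>
      0 < 2 - chi (x t) (z t) \<and> 0 < 1 + z t \<and> ereal \<bar>t\<bar> < conv_radius c"
    unfolding eventually_nhds_metric dist_real_def by auto
  show ?thesis
  proof (rule that[of "d / 2"])
    show "ereal (d / 2) \<le> conv_radius c" using d(2)[of "d / 2"] d(1) by auto
  qed (use d in \<open>auto simp: D_def\<close>)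
qed

text \<open>
Dividing the two equations gives \<open>\<xi> \<xi>' (2 - \<xi>\<^sup>2) powr (-3/2) = (1 + \<zeta>) \<zeta>'\<close>, an equality of exact
derivatives; the common factor \<open>e\<close> of the two right-hand sides cancels.
\<close>

lemma conserved_quantity:
  fixes x z e :: "real \<Rightarrow> real"
  assumes "\<bar>t\<bar> < d" and init: "x 0 = 1" "z 0 = 0"
    and pos: "\<And>t. \<bar>t\<bar> < d \<Longrightarrow> 0 < 2 - (x t)\<^sup>2"
    and x': "\<And>t. \<bar>t\<bar> < d \<Longrightarrow> (x has_real_derivative (1 + z t) * e t) (at t)"
    and z': "\<And>t. \<bar>t\<bar> < d \<Longrightarrow> (z has_real_derivative x t * e t / (2 - (x t)\<^sup>2) powr (3/2)) (at t)"
  shows "(2 - (x t)\<^sup>2) powr (-1/2) = Q (z t) / 2"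
proof -
  define L where "L t = (2 - (x t)\<^sup>2) powr (-1/2) - Q (z t) / 2" for t
  have "(L has_real_derivative 0) (at t within ball 0 d)" if "t \<in> ball 0 d" for t
  proof -
    from that have t: "\<bar>t\<bar> < d" by simp
    let ?w = "2 - (x t)\<^sup>2"
    have "((\<lambda>t. (2 - (x t)\<^sup>2) powr (-1/2)) has_real_derivative
        (-1/2) * ?w powr (-1/2 - 1) * (- (2 * x t * ((1 + z t) * e t)))) (at t)"
      using pos[OF t] by (auto intro!: derivative_eq_intros x'[OF t])
    moreover have "((\<lambda>t. Q (z t) / 2) has_real_derivative (1 + z t) * (x t * e t / ?w powr (3/2))) (at t)"
      unfolding Q_def
      by (rule derivative_eq_intros z'[OF t] refl | simp add: algebra_simps add_divide_distrib)+
    moreover have "?w powr (-1/2 - 1) = 1 / ?w powr (3/2)"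
      by (simp add: powr_minus_divide)
    ultimately have "(L has_real_derivative 0) (at t)"
      unfolding L_def by (auto dest: DERIV_diff)
    then show ?thesis by (rule has_field_derivative_at_within)
  qed
  from has_field_derivative_zero_constant[OF convex_ball this]
  obtain k where k: "\<And>t. t \<in> ball 0 d \<Longrightarrow> L t = k" by blast
  have "L t = L 0" using k[of t] k[of 0] assms(1) by auto
  then show ?thesis using init by (simp add: L_def Q_def)
qed

text \<open>
The three relations hold as functions near \<open>0\<close> and only involve polynomials and derivatives, so
they are identities of formal power series. In this form they no longer refer to a neighbourhood
and can be evaluated wherever the series converge.
\<close>

lemma power_series_solution_fps:
  fixes c :: "nat \<Rightarrow> real \<times> real"
  assumes "power_series_solution c"
  defines "X \<equiv> Abs_fps (\<lambda>n. fst (c n))" and "Z \<equiv> Abs_fps (\<lambda>n. snd (c n))"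
  shows "fps_nth X 0 = 1" "fps_nth Z 0 = 0" "0 < fps_nth X 1"
    "(Q Z)\<^sup>2 * (2 - X\<^sup>2) = 4"
    "(fps_deriv X)\<^sup>2 * (8 - P Z) = 8 * (1 + Z)\<^sup>2"
    "8 * (1 + Z) * fps_deriv Z = X * fps_deriv X * Q Z ^ 3"
proof -
  define x z where "x = (\<lambda>t. fst (power_series c t))" and "z = (\<lambda>t. snd (power_series c t))"
  define e where "e t = (2 - chi (x t) (z t)) powr (-1/2)" for t
  obtain d where d: "0 < d" "ereal d \<le> conv_radius c"
    and pos: "\<And>t. \<bar>t\<bar> < d \<Longrightarrow> 0 < 2 - (x t)\<^sup>2 \<and> 0 < 2 - chi (x t) (z t) \<and> 0 < 1 + z t"
    and x': "\<And>t. \<bar>t\<bar> < d \<Longrightarrow> (x has_real_derivative (1 + z t) * e t) (at t)"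
    and z': "\<And>t. \<bar>t\<bar> < d \<Longrightarrow>
        (z has_real_derivative x t * e t / (2 - (x t)\<^sup>2) powr (3/2)) (at t)"
    by (rule power_series_solution_local[OF assms(1) x_def z_def, folded e_def]) blast
  have init: "x 0 = 1" "z 0 = 0"
    using assms(1) unfolding power_series_solution_def solves_ivp_def x_def z_def by auto
  have repr: "represents (ereal d) X x" "represents (ereal d) Z z"
    using order_trans[OF d(2) conv_radius_components(1)] order_trans[OF d(2) conv_radius_components(2)]
      power_series_eq_eval_fps[OF less_le_trans[OF _ d(2)]]
    by (simp_all add: represents_def fps_conv_radius_def X_def Z_def x_def z_def)
  have alg: "(Q (z t))\<^sup>2 * (2 - (x t)\<^sup>2) = 4 \<and> 0 < e t \<and> (e t)\<^sup>2 * (8 - P (z t)) = 8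
      \<and> x t * e t / (2 - (x t)\<^sup>2) powr (3/2) = x t * e t * Q (z t) ^ 3 / 8" if "\<bar>t\<bar> < d" for t
  proof -
    have "(2 - (x t)\<^sup>2) powr (-1/2) = Q (z t) / 2"
      by (rule conserved_quantity[where x = x and z = z and e = e and d = d]) (use that init pos x' z' in auto)
    with pos[OF that] reduce_powers[of "x t" "z t"] show ?thesis unfolding e_def by blast
  qed
  have X': "eval_fps (fps_deriv X) t = (1 + z t) * e t" if "\<bar>t\<bar> < d" for t
    using represents_deriv[OF repr(1)] x'[OF that] that by (auto intro: DERIV_unique)
  have Z': "eval_fps (fps_deriv Z) t = x t * e t * Q (z t) ^ 3 / 8" if "\<bar>t\<bar> < d" for t
    using DERIV_unique[OF represents_deriv[OF repr(2)] z'[OF that]] that alg[OF that] by simp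
  note reprs = represents_intros repr repr[THEN represents_fps_deriv]
  show "fps_nth X 0 = 1" "fps_nth Z 0 = 0"
    using init d(1) represents_eval[OF repr(1), of 0] represents_eval[OF repr(2), of 0]
    by (simp_all add: eval_fps_at_0)
  have "fps_nth (fps_deriv X) 0 = e 0"
    using X'[of 0] d(1) init by (simp add: eval_fps_at_0)
  then show "0 < fps_nth X 1" using alg[of 0] d(1) by simp
  show "(Q Z)\<^sup>2 * (2 - X\<^sup>2) = 4"
  proof (rule represents_unique[of "ereal d"])
    show "represents (ereal d) ((Q Z)\<^sup>2 * (2 - X\<^sup>2)) (\<lambda>t. (Q (z t))\<^sup>2 * (2 - (x t)\<^sup>2))"
      unfolding Q_def by (intro reprs)
  qed (use d alg in \<open>auto intro: reprs\<close>)
  show "(fps_deriv X)\<^sup>2 * (8 - P Z) = 8 * (1 + Z)\<^sup>2"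
  proof (rule represents_unique[of "ereal d"])
    show "represents (ereal d) ((fps_deriv X)\<^sup>2 * (8 - P Z))
        (\<lambda>t. (eval_fps (fps_deriv X) t)\<^sup>2 * (8 - P (z t)))"
      unfolding P_def by (intro reprs)
    show "represents (ereal d) (8 * (1 + Z)\<^sup>2) (\<lambda>t. 8 * (1 + z t)\<^sup>2)" by (intro reprs)
    show "(eval_fps (fps_deriv X) t)\<^sup>2 * (8 - P (z t)) = 8 * (1 + z t)\<^sup>2"
      if "ereal \<bar>t\<bar> < ereal d" for t
    proof -
      from that have t: "\<bar>t\<bar> < d" by simp
      have "((1 + z t) * e t)\<^sup>2 * (8 - P (z t)) = (1 + z t)\<^sup>2 * ((e t)\<^sup>2 * (8 - P (z t)))"
        by (simp add: power_mult_distrib)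
      then show ?thesis using alg[OF t] unfolding X'[OF t] by simp
    qed
  qed (use d in simp)
  show "8 * (1 + Z) * fps_deriv Z = X * fps_deriv X * Q Z ^ 3"
  proof (rule represents_unique[of "ereal d"])
    show "represents (ereal d) (8 * (1 + Z) * fps_deriv Z)
        (\<lambda>t. 8 * (1 + z t) * eval_fps (fps_deriv Z) t)" by (intro reprs)
    show "represents (ereal d) (X * fps_deriv X * Q Z ^ 3)
        (\<lambda>t. x t * eval_fps (fps_deriv X) t * Q (z t) ^ 3)"
      unfolding Q_def by (intro reprs)
    show "8 * (1 + z t) * eval_fps (fps_deriv Z) t = x t * eval_fps (fps_deriv X) t * Q (z t) ^ 3"
      if "ereal \<bar>t\<bar> < ereal d" for t
      using that X'[of t] Z'[of t] by (simp add: field_simps)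
  qed (use d in simp)
qed

section \<open>Nonnegative coefficients\<close>

lemma fps_deriv_P: "fps_deriv (P Z) = P' Z * fps_deriv Z" for Z :: "real fps"
proof -
  have power: "fps_deriv (Z ^ numeral n) = numeral n * Z ^ (numeral n - 1) * fps_deriv Z" for n
    by (simp only: fps_deriv_power of_nat_numeral numeral_fps_const mult_ac)
  have scale: "fps_deriv (numeral n * F) = numeral n * fps_deriv F" for n and F :: "real fps"
    by (simp add: numeral_fps_const)
  show ?thesis
    unfolding P_def P'_def by (simp only: fps_deriv_add scale power) (simp add: algebra_simps)
qed

text \<open>
The third unknown \<open>E\<close> is the series of \<open>(2 - \<chi>) powr (-1/2)\<close>. Adjoining it makes the system
polynomial. Its own equation comes from differentiating \<open>E\<^sup>2 (8 - P Z) = 8\<close>, which gives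
\<open>16 E' = E\<^sup>3 (P Z)'\<close>, and inserting the equation for \<open>Z'\<close>. The right-hand sides have
nonnegative coefficients as polynomials in \<open>X\<close>, \<open>Z\<close>, \<open>E\<close>, which is the point of this form.
\<close>

lemma polynomial_system:
  fixes X Z E :: "real fps"
  assumes Z0: "fps_nth Z 0 = 0"
    and X': "(fps_deriv X)\<^sup>2 * (8 - P Z) = 8 * (1 + Z)\<^sup>2"
    and Z': "8 * (1 + Z) * fps_deriv Z = X * fps_deriv X * Q Z ^ 3"
  defines "E \<equiv> fps_deriv X * inverse (1 + Z)"
  shows "fps_deriv X = (1 + Z) * E"
    and "8 * fps_deriv Z = X * E * Q Z ^ 3"
    and "128 * fps_deriv E = E ^ 4 * P' Z * X * Q Z ^ 3"
proof -
  have unit: "fps_nth (1 + Z) 0 \<noteq> 0" using Z0 by simp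
  then have nz: "1 + Z \<noteq> 0" by (metis fps_zero_nth)
  show X'E: "fps_deriv X = (1 + Z) * E"
    using inverse_mult_eq_1[OF unit] unfolding E_def by (simp add: mult.left_commute mult.commute)
  have "(1 + Z)\<^sup>2 * (E\<^sup>2 * (8 - P Z)) = (1 + Z)\<^sup>2 * 8"
    using X' unfolding X'E by (simp add: power_mult_distrib mult_ac)
  then have E2: "E\<^sup>2 * (8 - P Z) = 8" using nz by simp
  have "(1 + Z) * (8 * fps_deriv Z) = (1 + Z) * (X * E * Q Z ^ 3)"
    using Z' unfolding X'E by (simp add: mult_ac)
  then show Z'E: "8 * fps_deriv Z = X * E * Q Z ^ 3" using nz by simp
  have "fps_deriv (E * E * (8 - P Z)) = fps_deriv 8"
    using E2 by (simp add: power2_eq_square)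
  then have "2 * E * fps_deriv E * (8 - P Z) = E\<^sup>2 * P' Z * fps_deriv Z"
    by (simp add: fps_deriv_P numeral_fps_const[of "num.Bit0 _"] algebra_simps power2_eq_square)
  then have "E * (2 * E * fps_deriv E * (8 - P Z)) = E * (E\<^sup>2 * P' Z * fps_deriv Z)" by simp
  moreover have "E * (2 * E * fps_deriv E * (8 - P Z)) = 2 * fps_deriv E * (E\<^sup>2 * (8 - P Z))"
    by (simp only: power2_eq_square mult_ac)
  moreover have "2 * fps_deriv E * (E\<^sup>2 * (8 - P Z)) = 16 * fps_deriv E"
    unfolding E2 by simp
  ultimately have E'16: "16 * fps_deriv E = E * (E\<^sup>2 * P' Z * fps_deriv Z)" by (simp only:)
  have "128 * fps_deriv E = 8 * (16 * fps_deriv E)" by simp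
  also have "\<dots> = E * (E\<^sup>2 * P' Z * (8 * fps_deriv Z))" unfolding E'16 by (simp only: mult_ac)
  also have "\<dots> = E ^ 4 * P' Z * X * Q Z ^ 3"
    unfolding Z'E by (simp only: power2_eq_square power4_eq_xxxx mult_ac)
  finally show "128 * fps_deriv E = E ^ 4 * P' Z * X * Q Z ^ 3" .
qed

definition nonneg_upto :: "nat \<Rightarrow> real fps \<Rightarrow> bool" where
  "nonneg_upto n F \<longleftrightarrow> (\<forall>k\<le>n. 0 \<le> fps_nth F k)"

lemma nonneg_upto_numeral: "nonneg_upto n (numeral k)"
  by (simp add: nonneg_upto_def numeral_fps_const)

lemma nonneg_upto_one: "nonneg_upto n 1"
  by (simp add: nonneg_upto_def)

lemma nonneg_upto_add: "nonneg_upto n F \<Longrightarrow> nonneg_upto n H \<Longrightarrow> nonneg_upto n (F + H)"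
  by (simp add: nonneg_upto_def)

lemma nonneg_upto_mult: "nonneg_upto n F \<Longrightarrow> nonneg_upto n H \<Longrightarrow> nonneg_upto n (F * H)"
  by (auto simp: nonneg_upto_def fps_mult_nth intro!: sum_nonneg)

lemma nonneg_upto_power: "nonneg_upto n F \<Longrightarrow> nonneg_upto n (F ^ k)"
  by (induction k) (simp_all add: nonneg_upto_one nonneg_upto_mult)

lemmas nonneg_upto_intros = nonneg_upto_numeral nonneg_upto_one nonneg_upto_add
  nonneg_upto_mult nonneg_upto_power

lemma nonneg_upto_Suc:
  assumes "nonneg_upto n F" "numeral k * fps_deriv F = H" "nonneg_upto n H"
  shows "nonneg_upto (Suc n) F"
proof -
  have "numeral k * (real (Suc n) * fps_nth F (Suc n)) = fps_nth H n"
    using assms(2) by (auto simp: numeral_fps_const)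
  moreover have "0 \<le> fps_nth H n" using assms(3) by (simp add: nonneg_upto_def)
  ultimately have "0 \<le> numeral k * (real (Suc n) * fps_nth F (Suc n))" by simp
  then have "0 \<le> fps_nth F (Suc n)" by (simp add: zero_le_mult_iff)
  then show ?thesis using assms(1) by (auto simp: nonneg_upto_def le_Suc_eq)
qed

text \<open>
The coefficient of order \<open>n + 1\<close> of each unknown is a positive multiple of the coefficient of order
\<open>n\<close> of its right-hand side, and that is a sum of products of coefficients of order at most \<open>n\<close>.
\<close>

lemma polynomial_system_nonneg:
  fixes X Z E :: "real fps"
  assumes "0 \<le> fps_nth X 0" "0 \<le> fps_nth Z 0" "0 \<le> fps_nth E 0"
    and X': "fps_deriv X = (1 + Z) * E"
    and Z': "8 * fps_deriv Z = X * E * Q Z ^ 3"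
    and E': "128 * fps_deriv E = E ^ 4 * P' Z * X * Q Z ^ 3"
  shows "nonneg_upto n X \<and> nonneg_upto n Z \<and> nonneg_upto n E"
proof (induction n)
  case 0
  show ?case using assms(1-3) by (simp add: nonneg_upto_def)
next
  case (Suc n)
  then have IH: "nonneg_upto n X" "nonneg_upto n Z" "nonneg_upto n E" by auto
  \<comment> \<open>A factor \<open>1\<close>, written as a numeral, brings this equation into the form of the other two.\<close>
  have "numeral Num.One * fps_deriv X = (1 + Z) * E" using X' by simp
  then have "nonneg_upto (Suc n) X"
    by (rule nonneg_upto_Suc[OF IH(1)]) (intro nonneg_upto_intros IH)
  moreover have "nonneg_upto (Suc n) Z"
    by (rule nonneg_upto_Suc[OF IH(2) Z']) (unfold Q_def, intro nonneg_upto_intros IH)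
  moreover have "nonneg_upto (Suc n) E"
    by (rule nonneg_upto_Suc[OF IH(3) E']) (unfold Q_def P'_def, intro nonneg_upto_intros IH)
  ultimately show ?case by blast
qed

section \<open>Partial sums\<close>

text \<open>
Nonnegativity is part of the notion because it is what makes the bounds multiplicative.
\<close>

definition bounded_by :: "nat \<Rightarrow> real \<Rightarrow> real fps \<Rightarrow> real \<Rightarrow> bool" where
  "bounded_by N t F b \<longleftrightarrow> (\<forall>k. 0 \<le> fps_nth F k) \<and> (\<Sum>k<N. fps_nth F k * t ^ k) \<le> b"

lemma bounded_by_numeral: "0 \<le> t \<Longrightarrow> bounded_by N t (numeral k) (numeral k)"
  by (auto simp: bounded_by_def numeral_fps_const if_distrib[of "\<lambda>x. x * _"] sum.delta cong: if_cong)

lemma bounded_by_one: "0 \<le> t \<Longrightarrow> bounded_by N t 1 1"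
  by (auto simp: bounded_by_def if_distrib[of "\<lambda>x. x * _"] sum.delta cong: if_cong)

lemma bounded_by_add:
  "bounded_by N t F a \<Longrightarrow> bounded_by N t H b \<Longrightarrow> bounded_by N t (F + H) (a + b)"
  by (auto simp: bounded_by_def distrib_right sum.distrib add_mono)

text \<open>
Truncating a product of nonnegative series drops nonnegative terms from the product of the
truncations: the triangle \<open>i + j < N\<close> lies in the square.
\<close>

lemma bounded_by_mult:
  assumes t: "0 \<le> t" and F: "bounded_by N t F a" and H: "bounded_by N t H b"
  shows "bounded_by N t (F * H) (a * b)"
  unfolding bounded_by_def
proof
  have F0: "\<And>k. 0 \<le> fps_nth F k" and H0: "\<And>k. 0 \<le> fps_nth H k"
    using F H by (auto simp: bounded_by_def)
  show "\<forall>k. 0 \<le> fps_nth (F * H) k" using F0 H0 by (auto simp: fps_mult_nth intro!: sum_nonneg)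
  let ?f = "\<lambda>(i, j). (fps_nth F i * t ^ i) * (fps_nth H j * t ^ j)"
  have "(\<Sum>k<N. fps_nth (F * H) k * t ^ k)
      = (\<Sum>k<N. \<Sum>i\<le>k. (fps_nth F i * t ^ i) * (fps_nth H (k - i) * t ^ (k - i)))"
  proof (rule sum.cong[OF refl])
    fix k
    have "fps_nth F i * fps_nth H (k - i) * t ^ k
        = (fps_nth F i * t ^ i) * (fps_nth H (k - i) * t ^ (k - i))" if "i \<le> k" for i
      using that power_add[of t i "k - i"] by simp
    then show "fps_nth (F * H) k * t ^ k
        = (\<Sum>i\<le>k. (fps_nth F i * t ^ i) * (fps_nth H (k - i) * t ^ (k - i)))"
      unfolding fps_mult_nth sum_distrib_right atLeast0AtMost by (intro sum.cong) auto
  qed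
  also have "\<dots> = sum ?f {(i, j). i + j < N}"
    by (rule sum.triangle_reindex[symmetric])
  also have "\<dots> \<le> sum ?f ({..<N} \<times> {..<N})"
    using t F0 H0 by (intro sum_mono2) auto
  also have "\<dots> = (\<Sum>k<N. fps_nth F k * t ^ k) * (\<Sum>k<N. fps_nth H k * t ^ k)"
    by (simp add: sum_product sum.cartesian_product)
  also have "\<dots> \<le> a * b"
    using F H t F0 H0 by (intro mult_mono') (auto simp: bounded_by_def intro!: sum_nonneg)
  finally show "(\<Sum>k<N. fps_nth (F * H) k * t ^ k) \<le> a * b" .
qed

lemma bounded_by_power: "0 \<le> t \<Longrightarrow> bounded_by N t F a \<Longrightarrow> bounded_by N t (F ^ k) (a ^ k)"
  by (induction k) (simp_all add: bounded_by_one bounded_by_mult)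

lemmas bounded_by_intros = bounded_by_numeral bounded_by_one bounded_by_add
  bounded_by_mult bounded_by_power

lemma bounded_by_numeral_multD:
  assumes "bounded_by N t (numeral n * F) b"
  shows "(\<Sum>k<N. fps_nth F k * t ^ k) \<le> b / numeral n"
proof -
  have "(\<Sum>k<N. fps_nth (numeral n * F) k * t ^ k) = numeral n * (\<Sum>k<N. fps_nth F k * t ^ k)"
    by (simp only: fps_mult_numeral_left sum_distrib_left mult.assoc)
  with assms show ?thesis by (simp add: bounded_by_def field_simps)
qed

lemma deriv_partial_sum:
  "((\<lambda>t. \<Sum>k<Suc N. fps_nth F k * t ^ k) has_real_derivative
    (\<Sum>k<N. fps_nth (fps_deriv F) k * t ^ k)) (at t)"
proof -
  have "((\<lambda>t. \<Sum>k<Suc N. fps_nth F k * t ^ k) has_real_derivative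
    (\<Sum>k<Suc N. fps_nth F k * (real k * t ^ (k - 1)))) (at t)"
    by (intro DERIV_sum) (auto intro!: derivative_eq_intros)
  also have "(\<Sum>k<Suc N. fps_nth F k * (real k * t ^ (k - 1)))
      = (\<Sum>k<N. fps_nth (fps_deriv F) k * t ^ k)"
    by (subst sum.lessThan_Suc_shift) (simp add: mult_ac del: sum.lessThan_Suc)
  finally show ?thesis .
qed

section \<open>The solution parametrised by its second component\<close>

lemma g_eq_Q: "g s = 2 / (Q s)\<^sup>2 * sqrt ((8 - P s) / ((Q s)\<^sup>2 - 2))"
proof -
  have "(Q s)\<^sup>2 - 2 = s ^ 4 + 4 * s ^ 3 + 8 * s\<^sup>2 + 8 * s + 2"
    unfolding Q_def by algebra
  then show ?thesis
    unfolding g_def P_def by (simp add: Q_def minus_divide_left)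
qed

lemma Q_ge_2: "0 \<le> s \<Longrightarrow> 2 \<le> Q s" for s :: real
  by (simp add: Q_def)

lemma Q_square_gt_2: "0 \<le> s \<Longrightarrow> 2 < (Q s)\<^sup>2" for s :: real
  using power_mono[OF Q_ge_2, of s 2] by simp

lemma P_strict_mono: "0 \<le> a \<Longrightarrow> a < b \<Longrightarrow> P a < P b" for a b :: real
  unfolding P_def by (intro add_strict_mono mult_strict_left_mono power_strict_mono) auto

lemma P_mono: "0 \<le> a \<Longrightarrow> a \<le> b \<Longrightarrow> P a \<le> P b" for a b :: real
  using P_strict_mono[of a b] by (cases "a = b") auto

lemma continuous_on_Q: "continuous_on A (Q :: real \<Rightarrow> real)"
  unfolding Q_def[abs_def] by (intro continuous_intros)

lemma continuous_on_P: "continuous_on A (P :: real \<Rightarrow> real)"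
  unfolding P_def[abs_def] by (intro continuous_intros)

lemma continuous_on_g: "continuous_on {0..} g"
  unfolding g_eq_Q
proof (intro continuous_intros continuous_on_Q continuous_on_P ballI)
  show "(Q s)\<^sup>2 \<noteq> 0" "(Q s)\<^sup>2 - 2 \<noteq> 0" if "s \<in> {0..}" for s :: real
    using Q_square_gt_2[of s] that by auto
qed

text \<open>
This is Cardano's formula. With \<open>s\<close> the cube root, \<open>Q v_plus = (4 + 2 y) / 9\<close> for \<open>y = s + 4 / s\<close>,
and the equation \<open>3 q\<^sup>3 - 4 q\<^sup>2 = 16\<close> for \<open>q = Q v_plus\<close> becomes \<open>y\<^sup>3 - 12 y = 502\<close>, that is
\<open>s\<^sup>6 - 502 s\<^sup>3 + 64 = 0\<close>, a quadratic equation for \<open>s\<^sup>3\<close>.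
\<close>

lemma v_plus_root: "0 < v_plus" "P v_plus = 8"
proof -
  define w where "w = sqrt 777"
  define s where "s = root 3 (251 + 9 * w)"
  have w: "0 < w" "w\<^sup>2 = 777" by (simp_all add: w_def)
  have s3: "s ^ 3 = 251 + 9 * w" using w by (simp add: s_def)
  have s: "7 < s"
  proof (rule power_less_imp_less_base)
    have "27 < w" unfolding w_def by (rule real_less_rsqrt) simp
    then show "7 ^ 3 < s ^ 3" unfolding s3 by simp
    show "0 \<le> s" using w by (simp add: s_def)
  qed
  have "(251 + 9 * w) powr (2/3) = s\<^sup>2"
    using w by (simp add: s_def root_powr_inverse power2_eq_square flip: powr_add)
  then have v: "v_plus = -1 + sqrt (502 + 18 * w - 5 * s\<^sup>2 + 8 * s) / (3 * s)"
    by (simp add: v_plus_def w_def[symmetric] s_def[symmetric])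
  have rad: "502 + 18 * w - 5 * s\<^sup>2 + 8 * s = s * (2 * s\<^sup>2 - 5 * s + 8)"
    using s3 by (simp add: algebra_simps power2_eq_square power3_eq_cube)
  have sq: "(sqrt (502 + 18 * w - 5 * s\<^sup>2 + 8 * s))\<^sup>2 = s * (2 * s\<^sup>2 - 5 * s + 8)"
  proof -
    have "0 \<le> s * (2 * s\<^sup>2 - 5 * s + 8)"
    proof (rule mult_nonneg_nonneg)
      have "0 \<le> s * (2 * s - 5)" using s by simp
      then show "0 \<le> 2 * s\<^sup>2 - 5 * s + 8" by (simp add: algebra_simps power2_eq_square)
    qed (use s in simp)
    then show ?thesis by (simp add: rad)
  qed
  have Qv: "9 * s * Q v_plus = 2 * s\<^sup>2 + 4 * s + 8"
  proof -
    have "Q v_plus = 1 + s * (2 * s\<^sup>2 - 5 * s + 8) / (9 * s\<^sup>2)"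
      unfolding Q_eq_square v by (simp add: power_divide power_mult_distrib sq)
    then have "s * (9 * s * Q v_plus) = s * (2 * s\<^sup>2 + 4 * s + 8)"
      using s by (simp add: field_simps power2_eq_square)
    then show ?thesis using s by simp
  qed
  have "s ^ 6 = (s ^ 3)\<^sup>2" by simp
  also have "\<dots> = 502 * s ^ 3 - 64"
    unfolding s3 using w(2) by (simp add: power2_eq_square algebra_simps)
  finally have s6: "s ^ 6 - 502 * s ^ 3 + 64 = 0" by simp
  \<comment> \<open>The factor \<open>(9 * s) ^ 3\<close> clears the denominators of \<open>Q v_plus\<close>.\<close>
  have "729 * s ^ 3 * (P v_plus - 8)
      = 3 * (9 * s * Q v_plus) ^ 3 - 36 * s * (9 * s * Q v_plus)\<^sup>2 - 11664 * s ^ 3"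
    unfolding P_eq_Q by (simp add: power2_eq_square power3_eq_cube algebra_simps)
  also have "\<dots> = 24 * (s ^ 6 - 502 * s ^ 3 + 64)"
    unfolding Qv by algebra
  finally show "P v_plus = 8" using s s6 by simp
  have "(3 * s)\<^sup>2 < s * (2 * s\<^sup>2 - 5 * s + 8)"
  proof -
    have "0 < s * (2 * s * (s - 7) + 8)" using s by (intro mult_pos_pos add_nonneg_pos) auto
    then show ?thesis by (simp add: algebra_simps power2_eq_square)
  qed
  then have "3 * s < sqrt (502 + 18 * w - 5 * s\<^sup>2 + 8 * s)"
    unfolding rad by (rule real_less_rsqrt)
  then show "0 < v_plus" using s by (simp add: v field_simps)
qed

text \<open>
\<open>G v\<close> is the time at which the second component reaches the value \<open>v\<close>.
\<close>

definition G :: "real \<Rightarrow> real" where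
  "G v = integral {0..v} g"

lemma G_deriv:
  assumes "0 < v"
  shows "(G has_real_derivative g v) (at v)"
proof -
  have "((\<lambda>u. integral {0..u} g) has_real_derivative g v) (at v within {0..v + 1})"
    using assms continuous_on_subset[OF continuous_on_g, of "{0..v + 1}"]
    by (intro integral_has_real_derivative) auto
  then show ?thesis
    using assms at_within_interior[of v "{0..v + 1}"] by (simp add: G_def[abs_def])
qed

lemma continuous_on_G: "continuous_on {0..b} G"
  unfolding G_def[abs_def]
  by (intro indefinite_integral_continuous_1 integrable_continuous_real
      continuous_on_subset[OF continuous_on_g]) auto

lemma g_pos:
  assumes "0 \<le> v" "v < v_plus"
  shows "0 < g v"
  using P_strict_mono[OF assms] v_plus_root Q_square_gt_2[OF assms(1)] Q_pos[of v]
  by (simp add: g_eq_Q)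

lemma G_strict_mono:
  assumes "0 \<le> u" "u < v" "v \<le> v_plus"
  shows "G u < G v"
proof (rule DERIV_pos_imp_increasing_open[OF assms(2)])
  show "\<exists>y. (G has_real_derivative y) (at x) \<and> 0 < y" if "u < x" "x < v" for x
    using that assms by (intro exI[of _ "g x"] conjI G_deriv g_pos) auto
  show "continuous_on {u..v} G"
    by (rule continuous_on_subset[OF continuous_on_G[of v]]) (use assms in auto)
qed

lemma G_0: "G 0 = 0"
  by (simp add: G_def)

text \<open>
The first component and the value of \<open>(2 - \<chi>) powr (-1/2)\<close> at the moment when the second component
is \<open>v\<close>. As functions of \<open>v\<close> they are explicit, which spares inverting \<open>G\<close>.
\<close>

definition xi_of :: "real \<Rightarrow> real" where
  "xi_of v = sqrt (2 - 4 / (Q v)\<^sup>2)"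

definition speed_of :: "real \<Rightarrow> real" where
  "speed_of v = sqrt (8 / (8 - P v))"

lemma four_over_Q_square: "0 \<le> v \<Longrightarrow> 4 / (Q v)\<^sup>2 < 2" for v :: real
  using Q_square_gt_2[of v] Q_pos[of v] by (simp add: pos_divide_less_eq)

text \<open>
By this relation \<open>\<zeta>' = 1 / g \<zeta>\<close>, because the second equation of the polynomial system reads
\<open>8 \<zeta>' = \<xi> e Q\<^sup>3\<close>.
\<close>

lemma g_mult_speed:
  assumes "0 \<le> v" "P v < 8"
  shows "g v * (xi_of v * speed_of v * Q v ^ 3) = 8"
proof -
  have q: "0 < Q v" "0 < (Q v)\<^sup>2 - 2" using Q_pos[of v] Q_square_gt_2[OF assms(1)] by auto
  have "sqrt ((8 - P v) / ((Q v)\<^sup>2 - 2)) * xi_of v * speed_of v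
      = sqrt ((8 - P v) / ((Q v)\<^sup>2 - 2) * (2 - 4 / (Q v)\<^sup>2) * (8 / (8 - P v)))"
    by (simp only: xi_of_def speed_of_def real_sqrt_mult)
  also have "(8 - P v) / ((Q v)\<^sup>2 - 2) * (2 - 4 / (Q v)\<^sup>2) * (8 / (8 - P v)) = (4 / Q v)\<^sup>2"
  proof -
    have "2 - 4 / (Q v)\<^sup>2 = 2 * ((Q v)\<^sup>2 - 2) / (Q v)\<^sup>2"
      using q(1) by (simp add: diff_divide_distrib)
    moreover have "a / b * (2 * b / c) * (8 / a) = 16 / c" if "a \<noteq> 0" "b \<noteq> 0" for a b c :: real
      using that by simp
    from this[of "8 - P v" "(Q v)\<^sup>2 - 2" "(Q v)\<^sup>2"]
    have "(8 - P v) / ((Q v)\<^sup>2 - 2) * (2 * ((Q v)\<^sup>2 - 2) / (Q v)\<^sup>2) * (8 / (8 - P v)) = 16 / (Q v)\<^sup>2"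
      using q(2) assms(2) by linarith
    ultimately show ?thesis by (simp only: power_divide) simp
  qed
  also have "sqrt ((4 / Q v)\<^sup>2) = 4 / Q v" using q by simp
  finally have *: "sqrt ((8 - P v) / ((Q v)\<^sup>2 - 2)) * xi_of v * speed_of v = 4 / Q v" .
  have "g v * (xi_of v * speed_of v * Q v ^ 3)
      = 2 / (Q v)\<^sup>2 * Q v ^ 3 * (sqrt ((8 - P v) / ((Q v)\<^sup>2 - 2)) * xi_of v * speed_of v)"
    by (simp add: g_eq_Q)
  also have "\<dots> = 8" unfolding * using q by (simp add: power2_eq_square power3_eq_cube)
  finally show ?thesis .
qed

text \<open>
Multiplying the right-hand sides of the system by \<open>g v = d\<tau>/dv\<close> gives the derivatives with respect
to \<open>v\<close>.
\<close>

lemma xi_of_deriv: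
  assumes v: "0 \<le> v" "P v < 8"
  shows "(xi_of has_real_derivative g v * ((1 + v) * speed_of v)) (at v)"
proof -
  have q: "0 < Q v" using Q_pos .
  have pos: "0 < xi_of v" unfolding xi_of_def using four_over_Q_square[OF v(1)] by simp
  have "(Q has_real_derivative 2 * (1 + v)) (at v)"
    unfolding Q_def by (auto intro!: derivative_eq_intros)
  then have "((\<lambda>v. 2 - 4 / (Q v)\<^sup>2) has_real_derivative
      4 * (2 * (2 * (1 + v)) * Q v) / ((Q v)\<^sup>2)\<^sup>2) (at v)"
    using q by (auto intro!: derivative_eq_intros simp: power2_eq_square)
  also have "4 * (2 * (2 * (1 + v)) * Q v) / ((Q v)\<^sup>2)\<^sup>2 = 16 * (1 + v) / Q v ^ 3"
    using q by (simp add: power2_eq_square power3_eq_cube)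
  finally have this0: "((\<lambda>v. 2 - 4 / (Q v)\<^sup>2) has_real_derivative 16 * (1 + v) / Q v ^ 3) (at v)" .
  have pos': "0 < 2 - 4 / (Q v)\<^sup>2" using four_over_Q_square[OF v(1)] by simp
  from DERIV_chain2[where f = sqrt and g = "\<lambda>v. 2 - 4 / (Q v)\<^sup>2", OF DERIV_real_sqrt[OF pos'] this0]
  have "(xi_of has_real_derivative inverse (xi_of v) / 2 * (16 * (1 + v) / Q v ^ 3)) (at v)"
    unfolding xi_of_def[abs_def] .
  also have "inverse (xi_of v) / 2 * (16 * (1 + v) / Q v ^ 3) = 8 * (1 + v) / (xi_of v * Q v ^ 3)"
    using pos q by (simp add: field_simps)
  also have "\<dots> = g v * (xi_of v * speed_of v * Q v ^ 3) * (1 + v) / (xi_of v * Q v ^ 3)"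
    unfolding g_mult_speed[OF v] ..
  also have "\<dots> = g v * ((1 + v) * speed_of v)"
    using pos q by simp
  finally show ?thesis .
qed

lemma speed_of_deriv:
  assumes v: "0 \<le> v" "P v < 8"
  shows "(speed_of has_real_derivative g v * (speed_of v ^ 4 * P' v * xi_of v * Q v ^ 3 / 128)) (at v)"
proof -
  have pos: "0 < 8 / (8 - P v)" using v by simp
  have e: "0 < speed_of v" "(speed_of v)\<^sup>2 = 8 / (8 - P v)"
    using pos unfolding speed_of_def by simp_all
  have "(P has_real_derivative P' v) (at v)"
    unfolding P_def P'_def by (auto intro!: derivative_eq_intros)
  then have "((\<lambda>v. 8 / (8 - P v)) has_real_derivative 8 * P' v / (8 - P v)\<^sup>2) (at v)"
    using v by (auto intro!: derivative_eq_intros simp: power2_eq_square)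
  from DERIV_chain2[where f = sqrt and g = "\<lambda>v. 8 / (8 - P v)", OF DERIV_real_sqrt[OF pos] this]
  have "(speed_of has_real_derivative
      inverse (speed_of v) / 2 * (8 * P' v / (8 - P v)\<^sup>2)) (at v)"
    unfolding speed_of_def[abs_def] .
  also have "8 * P' v / (8 - P v)\<^sup>2 = P' v * ((speed_of v)\<^sup>2)\<^sup>2 / 8"
    unfolding e(2) by (simp add: power_divide)
  also have "inverse (speed_of v) / 2 * (P' v * ((speed_of v)\<^sup>2)\<^sup>2 / 8) = speed_of v ^ 3 * P' v / 16"
    using e(1) by (simp add: power2_eq_square power3_eq_cube field_simps)
  also have "\<dots> = g v * (xi_of v * speed_of v * Q v ^ 3) * (speed_of v ^ 3 * P' v) / 128"
    unfolding g_mult_speed[OF v] by simp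
  also have "\<dots> = g v * (speed_of v ^ 4 * P' v * xi_of v * Q v ^ 3 / 128)"
    by (simp add: power3_eq_cube power4_eq_xxxx)
  finally show ?thesis .
qed

section \<open>The radius of convergence\<close>

text \<open>
One Picard step for a scalar component. The derivative of the next partial sum is the current
partial sum of the derivative, so a bound on the latter by \<open>f'\<close> integrates to a bound on the former
by \<open>f\<close>. Time is \<open>\<tau> = G u\<close>, hence the factor \<open>g u\<close>.
\<close>

lemma partial_sum_Suc_le:
  assumes v: "0 \<le> v" "v < v_plus"
    and init: "fps_nth F 0 = f 0"
    and deriv: "\<And>u. 0 \<le> u \<Longrightarrow> u \<le> v \<Longrightarrow> (f has_real_derivative g u * f' u) (at u)"
    and bound: "\<And>u. 0 \<le> u \<Longrightarrow> u \<le> v \<Longrightarrow> (\<Sum>k<N. fps_nth (fps_deriv F) k * G u ^ k) \<le> f' u"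
  shows "(\<Sum>k<Suc N. fps_nth F k * G v ^ k) \<le> f v"
proof -
  define S where "S t = (\<Sum>k<Suc N. fps_nth F k * t ^ k)" for t
  have "f 0 - S (G 0) \<le> f v - S (G v)"
  proof (rule DERIV_nonneg_imp_increasing_open[OF v(1)])
    fix u assume u: "0 < u" "u < v"
    have "((\<lambda>u. S (G u)) has_real_derivative (\<Sum>k<N. fps_nth (fps_deriv F) k * G u ^ k) * g u) (at u)"
      unfolding S_def by (rule DERIV_chain2[OF deriv_partial_sum G_deriv[OF u(1)]])
    with deriv[of u] u have "((\<lambda>u. f u - S (G u)) has_real_derivative
        g u * f' u - (\<Sum>k<N. fps_nth (fps_deriv F) k * G u ^ k) * g u) (at u)"
      by (intro DERIV_diff) auto
    moreover have "0 \<le> g u * (f' u - (\<Sum>k<N. fps_nth (fps_deriv F) k * G u ^ k))"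
      using bound[of u] g_pos[of u] u v by simp
    ultimately show "\<exists>y. ((\<lambda>u. f u - S (G u)) has_real_derivative y) (at u) \<and> 0 \<le> y"
      by (intro exI conjI) (auto simp: algebra_simps)
  next
    have "continuous_on {0..v} f"
      using deriv by (intro continuous_at_imp_continuous_on ballI) (auto intro: DERIV_isCont)
    then show "continuous_on {0..v} (\<lambda>u. f u - S (G u))"
      unfolding S_def by (intro continuous_intros continuous_on_G)
  qed
  moreover have "S (G 0) = f 0"
    unfolding S_def G_0 sum.lessThan_Suc_shift by (simp add: init)
  ultimately show ?thesis by (simp add: S_def)
qed

text \<open>
The Picard iterates increase to the solution from below: the right-hand sides are monotone in the
unknowns, and truncating them only makes them smaller. The explicit solution therefore dominates
all partial sums for as long as it exists, that is for \<open>v < v_plus\<close>.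
\<close>

lemma partial_sums_le:
  fixes X Z E :: "real fps"
  assumes nonneg: "\<And>k. 0 \<le> fps_nth X k" "\<And>k. 0 \<le> fps_nth Z k" "\<And>k. 0 \<le> fps_nth E k"
    and init: "fps_nth X 0 = 1" "fps_nth Z 0 = 0" "fps_nth E 0 = 1"
    and X': "fps_deriv X = (1 + Z) * E"
    and Z': "8 * fps_deriv Z = X * E * Q Z ^ 3"
    and E': "128 * fps_deriv E = E ^ 4 * P' Z * X * Q Z ^ 3"
    and "0 \<le> v" "v < v_plus"
  shows "(\<Sum>k<N. fps_nth X k * G v ^ k) \<le> xi_of v \<and> (\<Sum>k<N. fps_nth Z k * G v ^ k) \<le> v
    \<and> (\<Sum>k<N. fps_nth E k * G v ^ k) \<le> speed_of v"
  using \<open>0 \<le> v\<close> \<open>v < v_plus\<close>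
proof (induction N arbitrary: v)
  case 0
  then show ?case
    using P_strict_mono[of v v_plus] v_plus_root four_over_Q_square[of v]
    by (simp add: xi_of_def speed_of_def)
next
  case (Suc N)
  have bnd: "bounded_by N (G u) X (xi_of u)" "bounded_by N (G u) Z u" "bounded_by N (G u) E (speed_of u)"
    and G0: "0 \<le> G u" and P8: "P u < 8"
    if "0 \<le> u" "u \<le> v" for u
    using Suc.IH[of u] that Suc.prems nonneg G_strict_mono[of 0 u] P_strict_mono[of u v_plus]
    by (auto simp: bounded_by_def v_plus_root G_0 order.order_iff_strict)
  have sumX: "(\<Sum>k<N. fps_nth (fps_deriv X) k * G u ^ k) \<le> (1 + u) * speed_of u"
    if u: "0 \<le> u" "u \<le> v" for u
  proof -
    have "bounded_by N (G u) ((1 + Z) * E) ((1 + u) * speed_of u)"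
      by (intro bounded_by_intros bnd[OF u] G0[OF u])
    then show ?thesis by (simp add: X' bounded_by_def)
  qed
  have sumZ: "(\<Sum>k<N. fps_nth (fps_deriv Z) k * G u ^ k) \<le> xi_of u * speed_of u * Q u ^ 3 / 8"
    if u: "0 \<le> u" "u \<le> v" for u
  proof -
    have "bounded_by N (G u) (X * E * Q Z ^ 3) (xi_of u * speed_of u * Q u ^ 3)"
      unfolding Q_def by (intro bounded_by_intros bnd[OF u] G0[OF u])
    then show ?thesis unfolding Z'[symmetric] by (rule bounded_by_numeral_multD)
  qed
  have sumE: "(\<Sum>k<N. fps_nth (fps_deriv E) k * G u ^ k)
      \<le> speed_of u ^ 4 * P' u * xi_of u * Q u ^ 3 / 128"
    if u: "0 \<le> u" "u \<le> v" for u
  proof -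
    have "bounded_by N (G u) (E ^ 4 * P' Z * X * Q Z ^ 3) (speed_of u ^ 4 * P' u * xi_of u * Q u ^ 3)"
      unfolding Q_def P'_def by (intro bounded_by_intros bnd[OF u] G0[OF u])
    then show ?thesis unfolding E'[symmetric] by (rule bounded_by_numeral_multD)
  qed
  have "(\<Sum>k<Suc N. fps_nth X k * G v ^ k) \<le> xi_of v"
    by (rule partial_sum_Suc_le[OF Suc.prems _ xi_of_deriv[OF _ P8] sumX])
      (simp_all add: init xi_of_def Q_def)
  moreover have "(\<Sum>k<Suc N. fps_nth Z k * G v ^ k) \<le> v"
  proof (rule partial_sum_Suc_le[OF Suc.prems, where f = "\<lambda>v. v"])
    show "((\<lambda>v. v) has_real_derivative g u * (xi_of u * speed_of u * Q u ^ 3 / 8)) (at u)"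
      if "0 \<le> u" "u \<le> v" for u
      using g_mult_speed[OF that(1) P8[OF that]] by (auto intro!: derivative_eq_intros)
  qed (use sumZ init in auto)
  moreover have "(\<Sum>k<Suc N. fps_nth E k * G v ^ k) \<le> speed_of v"
    by (rule partial_sum_Suc_le[OF Suc.prems _ speed_of_deriv[OF _ P8] sumE])
      (simp_all add: init speed_of_def P_def)
  ultimately show ?case by blast
qed

lemma conv_radius_ge_if_partial_sums_le:
  fixes F :: "real fps"
  assumes nonneg: "\<And>k. 0 \<le> fps_nth F k"
    and bound: "\<And>v N. 0 \<le> v \<Longrightarrow> v < v_plus \<Longrightarrow> (\<Sum>k<N. fps_nth F k * G v ^ k) \<le> b v"
  shows "ereal (G v_plus) \<le> fps_conv_radius F"
  unfolding fps_conv_radius_def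
proof (rule conv_radius_geI_ex')
  fix r :: real assume r: "0 < r" "ereal r < ereal (G v_plus)"
  obtain v where v: "0 \<le> v" "v \<le> v_plus" "G v = r"
    using IVT'[of G 0 r v_plus] r v_plus_root(1) continuous_on_G by (auto simp: G_0)
  then have "v < v_plus" using r by (cases "v = v_plus") auto
  then have "summable (\<lambda>k. fps_nth F k * G v ^ k)"
    using bound[of v] v r nonneg by (intro summableI_nonneg_bounded[where x = "b v"]) auto
  then show "summable (\<lambda>k. fps_nth F k * of_real r ^ k)" by (simp add: v)
qed

lemma eval_fps_nonneg:
  fixes F :: "real fps"
  assumes "\<And>k. 0 \<le> fps_nth F k" "0 \<le> t" "ereal t < fps_conv_radius F"
  shows "0 \<le> eval_fps F t"
  unfolding eval_fps_def using assms summable_fps[of t F] by (intro suminf_nonneg) auto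

text \<open>
Suppose that the series converge on a longer interval. The first-order relations persist there,
and \<open>(x')\<^sup>2 (8 - P z) = 8 (1 + z)\<^sup>2\<close> keeps \<open>P z < 8\<close>, that is \<open>z < v_plus\<close>. Nonnegativity selects the
roots \<open>x = xi_of z\<close> and \<open>x' = (1 + z) * speed_of z\<close>, so \<open>z' = 1 / g z\<close> and \<open>G (z T) = T\<close> at every
time \<open>T\<close>, although \<open>G\<close> stays below \<open>G v_plus\<close>.
\<close>

lemma conv_radius_le_G:
  fixes X Z :: "real fps"
  assumes rad: "\<rho> \<le> fps_conv_radius X" "\<rho> \<le> fps_conv_radius Z"
    and nonneg: "\<And>k. 0 \<le> fps_nth X k" "\<And>k. 0 \<le> fps_nth Z k"
    and init: "fps_nth Z 0 = 0"
    and conserved: "(Q Z)\<^sup>2 * (2 - X\<^sup>2) = 4"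
    and X': "(fps_deriv X)\<^sup>2 * (8 - P Z) = 8 * (1 + Z)\<^sup>2"
    and Z': "8 * (1 + Z) * fps_deriv Z = X * fps_deriv X * Q Z ^ 3"
  shows "\<rho> \<le> ereal (G v_plus)"
proof (rule ccontr)
  assume "\<not> \<rho> \<le> ereal (G v_plus)"
  then obtain T where T: "G v_plus < T" "ereal T < \<rho>"
    using ereal_dense2[of "ereal (G v_plus)" \<rho>] by (auto simp: not_le)
  define x z x' z' where "x = eval_fps X" and "z = eval_fps Z"
    and "x' = eval_fps (fps_deriv X)" and "z' = eval_fps (fps_deriv Z)"
  have repr: "represents \<rho> X x" "represents \<rho> Z z"
    "represents \<rho> (fps_deriv X) x'" "represents \<rho> (fps_deriv Z) z'"
    using rad represents_fps_deriv[of \<rho> X x] represents_fps_deriv[of \<rho> Z z]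
    by (auto simp: represents_def x_def z_def x'_def z'_def)
  note reprs = represents_intros repr
  have G0: "0 < G v_plus" using G_strict_mono[of 0 v_plus] v_plus_root(1) by (simp add: G_0)
  have z0: "z 0 = 0" by (simp add: z_def eval_fps_at_0 init)
  have identities: "0 \<le> z s \<and> z s < v_plus \<and> 8 * z' s = xi_of (z s) * speed_of (z s) * Q (z s) ^ 3"
    if s: "0 \<le> s" "s \<le> T" for s
  proof -
    have s\<rho>: "ereal \<bar>s\<bar> < \<rho>" using s T(2) by (auto intro: le_less_trans[of _ "ereal T"])
    have pos: "0 \<le> x s" "0 \<le> z s" "0 \<le> x' s"
      using s s\<rho> rad nonneg fps_conv_radius_deriv[of X] unfolding x_def z_def x'_def
      by (auto intro!: eval_fps_nonneg simp: less_le_trans)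
    have "represents \<rho> ((Q Z)\<^sup>2 * (2 - X\<^sup>2)) (\<lambda>t. (Q (z t))\<^sup>2 * (2 - (x t)\<^sup>2))"
      unfolding Q_def by (intro reprs)
    from represents_eval[OF this s\<rho>] have 1: "(Q (z s))\<^sup>2 * (2 - (x s)\<^sup>2) = 4"
      unfolding conserved by simp
    have lhs2: "represents \<rho> ((fps_deriv X)\<^sup>2 * (8 - P Z)) (\<lambda>t. (x' t)\<^sup>2 * (8 - P (z t)))"
      unfolding P_def by (intro reprs)
    have rhs2: "represents \<rho> (8 * (1 + Z)\<^sup>2) (\<lambda>t. 8 * (1 + z t)\<^sup>2)" by (intro reprs)
    have 2: "(x' s)\<^sup>2 * (8 - P (z s)) = 8 * (1 + z s)\<^sup>2"
      using represents_eval[OF lhs2 s\<rho>] represents_eval[OF rhs2 s\<rho>] by (simp only: X')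
    have lhs3: "represents \<rho> (8 * (1 + Z) * fps_deriv Z) (\<lambda>t. 8 * (1 + z t) * z' t)" by (intro reprs)
    have rhs3: "represents \<rho> (X * fps_deriv X * Q Z ^ 3) (\<lambda>t. x t * x' t * Q (z t) ^ 3)"
      unfolding Q_def by (intro reprs)
    have 3: "8 * (1 + z s) * z' s = x s * x' s * Q (z s) ^ 3"
      using represents_eval[OF lhs3 s\<rho>] represents_eval[OF rhs3 s\<rho>] by (simp only: Z')
    have "0 < 8 * (1 + z s)\<^sup>2" using pos by simp
    then have P8: "P (z s) < 8" unfolding 2[symmetric] by (simp add: zero_less_mult_iff)
    have "z s < v_plus"
      using P_strict_mono[of v_plus "z s"] P8 v_plus_root by (cases "v_plus < z s") (auto simp: not_less order.order_iff_strict)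
    moreover have "x s = xi_of (z s)"
    proof -
      have "(x s)\<^sup>2 = 2 - 4 / (Q (z s))\<^sup>2" using 1 Q_pos[of "z s"] by (simp add: field_simps)
      then show ?thesis unfolding xi_of_def using pos(1) by (metis real_sqrt_unique)
    qed
    moreover have "x' s = (1 + z s) * speed_of (z s)"
    proof -
      have "(x' s / (1 + z s))\<^sup>2 = 8 / (8 - P (z s))"
        using 2 pos P8 by (simp add: field_simps power_divide)
      then have "x' s / (1 + z s) = speed_of (z s)"
        unfolding speed_of_def using pos by (metis add_nonneg_nonneg divide_nonneg_nonneg real_sqrt_unique zero_le_one)
      then show ?thesis using pos by (simp add: field_simps)
    qed
    ultimately have "(1 + z s) * (8 * z' s) = (1 + z s) * (xi_of (z s) * speed_of (z s) * Q (z s) ^ 3)"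
      using 3 by (simp add: mult_ac)
    then show ?thesis using pos \<open>z s < v_plus\<close> by simp
  qed
  have z_deriv: "(z has_real_derivative z' s) (at s)" if "0 \<le> s" "s \<le> T" for s
  proof -
    have "ereal \<bar>s\<bar> < \<rho>" using that T(2) by (auto intro: le_less_trans[of _ "ereal T"])
    from represents_deriv[OF repr(2) this] show ?thesis by (simp add: z'_def)
  qed
  have speed: "g (z s) * z' s = 1 \<and> 0 < z' s" if "0 \<le> s" "s \<le> T" for s
  proof -
    have "P (z s) < 8" using identities[OF that] P_strict_mono[of "z s" v_plus] v_plus_root by auto
    with identities[OF that] have "g (z s) * z' s = 1"
      using g_mult_speed[of "z s"] by (metis mult.left_commute mult_cancel_left mult.right_neutral zero_neq_numeral)
    moreover have "0 < g (z s)" using identities[OF that] g_pos by blast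
    ultimately show ?thesis by (metis zero_less_mult_pos zero_less_one)
  qed
  have z_pos: "0 < z s" if "0 < s" "s \<le> T" for s
  proof -
    have "z 0 < z s"
    proof (rule DERIV_pos_imp_increasing[OF that(1)])
      show "\<exists>y. (z has_real_derivative y) (at u) \<and> 0 < y" if "0 \<le> u" "u \<le> s" for u
        using z_deriv[of u] speed[of u] that \<open>s \<le> T\<close> by auto
    qed
    then show ?thesis by (simp add: z0)
  qed
  have "G (z T) - T = G (z 0) - 0"
  proof (rule DERIV_isconst_end[where f = "\<lambda>s. G (z s) - s" and a = 0 and b = T])
    show "0 < T" using G0 T by simp
    have "continuous_on {0..T} z"
      using z_deriv by (intro continuous_at_imp_continuous_on ballI) (auto intro: DERIV_isCont)
    moreover have "z ` {0..T} \<subseteq> {0..v_plus}"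
      using identities by (auto simp: less_imp_le)
    ultimately have "continuous_on {0..T} (\<lambda>s. G (z s))"
      by (rule continuous_on_compose2[OF continuous_on_G])
    then show "continuous_on {0..T} (\<lambda>s. G (z s) - s)"
      by (intro continuous_intros)
    show "((\<lambda>s. G (z s) - s) has_real_derivative 0) (at s)" if "0 < s" "s < T" for s
      using DERIV_chain2[OF G_deriv[OF z_pos[of s]] z_deriv[of s]] speed[of s] that
      by (auto intro!: derivative_eq_intros)
  qed
  then have "G (z T) = T" by (simp add: z0 G_0)
  moreover have "G (z T) \<le> G v_plus"
    using identities[of T] G_strict_mono[of "z T" v_plus] G0 T by auto
  ultimately show False using T by simp
qed

lemma conv_radius_eq_G:
  fixes c :: "nat \<Rightarrow> real \<times> real"
  assumes "power_series_solution c"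
  shows "conv_radius c = ereal (G v_plus)"
proof -
  define X Z where "X = Abs_fps (\<lambda>n. fst (c n))" and "Z = Abs_fps (\<lambda>n. snd (c n))"
  note fps = power_series_solution_fps[OF assms, folded X_def Z_def]
  define E where "E = fps_deriv X * inverse (1 + Z)"
  note system = polynomial_system[OF fps(2,5,6), folded E_def]
  have "fps_nth ((fps_deriv X)\<^sup>2 * (8 - P Z)) 0 = fps_nth (8 * (1 + Z)\<^sup>2) 0" by (simp only: fps(5))
  then have "(fps_nth X 1)\<^sup>2 = 1"
    by (simp add: P_def fps(2) fps_power_zeroth numeral_fps_const)
  then have "fps_nth X 1 = 1" using fps(3) by (simp add: power2_eq_1_iff)
  then have E0: "fps_nth E 0 = 1" by (simp add: E_def fps(2))
  have nonneg: "0 \<le> fps_nth X k" "0 \<le> fps_nth Z k" "0 \<le> fps_nth E k" for k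
    using polynomial_system_nonneg[OF _ _ _ system, of k] fps(1,2) E0
    by (auto simp: nonneg_upto_def)
  note le = partial_sums_le[OF nonneg fps(1,2) E0 system]
  have "ereal (G v_plus) \<le> fps_conv_radius X" "ereal (G v_plus) \<le> fps_conv_radius Z"
    by (rule conv_radius_ge_if_partial_sums_le; use nonneg le in blast)+
  then have "ereal (G v_plus) \<le> conv_radius c"
    by (intro conv_radius_ge_components) (simp_all add: X_def Z_def fps_conv_radius_def)
  moreover have "conv_radius c \<le> ereal (G v_plus)"
    by (rule conv_radius_le_G[OF _ _ nonneg(1,2) fps(2,4,5,6)])
      (simp_all add: X_def Z_def fps_conv_radius_def conv_radius_components)
  ultimately show ?thesis by simp
qed

section \<open>Bounding the integral by explicit antiderivatives\<close>

text \<open>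
In terms of \<open>q = Q s\<close> the integrand is \<open>dq\<close> times \<open>sqrt (16 + 4 q\<^sup>2 - 3 q\<^sup>3) / sqrt (radicand_denominator q)\<close>,
which vanishes like a square root at the root of the cubic. Let \<open>a\<close> be close to that root. Up to a tiny
error the integrand is then \<open>sqrt (a - q)\<close> times the function
\<open>sqrt (cubic_quotient a q / radicand_denominator q)\<close>, which is analytic on the whole range and hence
well approximated by a polynomial. The trial antiderivative is \<open>- (a - q) powr (3/2) * \<Psi> q\<close>, and
\<open>weight\<close> is what remains of its derivative in \<open>q\<close> after removing the factor \<open>sqrt (a - q)\<close>.
\<close>

definition primitive :: "real \<Rightarrow> (real \<Rightarrow> real) \<Rightarrow> real \<Rightarrow> real" where
  "primitive a \<Psi> s = - ((a - Q s) * sqrt (a - Q s) * \<Psi> (Q s))"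

definition weight :: "real \<Rightarrow> (real \<Rightarrow> real) \<Rightarrow> (real \<Rightarrow> real) \<Rightarrow> real \<Rightarrow> real" where
  "weight a \<Psi> \<Psi>' q = 3 / 2 * \<Psi> q - (a - q) * \<Psi>' q"

definition cubic_quotient :: "real \<Rightarrow> real \<Rightarrow> real" where
  "cubic_quotient a q = 3 * (q\<^sup>2 + q * a + a\<^sup>2) - 4 * (q + a)"

definition radicand_denominator :: "real \<Rightarrow> real" where
  "radicand_denominator q = (q - 1) * q ^ 4 * (q\<^sup>2 - 2)"

lemma cubic_quotient_eq: "(a - q) * cubic_quotient a q = (3 * a ^ 3 - 4 * a\<^sup>2) - (3 * q ^ 3 - 4 * q\<^sup>2)"
  unfolding cubic_quotient_def by algebra

lemma primitive_deriv:
  assumes "Q s < a" and \<Psi>: "(\<Psi> has_real_derivative \<Psi>' (Q s)) (at (Q s))"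
  shows "(primitive a \<Psi> has_real_derivative
    2 * (1 + s) * sqrt (a - Q s) * weight a \<Psi> \<Psi>' (Q s)) (at s)"
proof -
  define t where "t = a - Q s"
  have t: "0 < t" "sqrt t * sqrt t = t" using assms(1) by (simp_all add: t_def)
  have Q: "(Q has_real_derivative 2 * (1 + s)) (at s)"
    unfolding Q_def by (auto intro!: derivative_eq_intros)
  have \<Psi>Q: "((\<lambda>s. \<Psi> (Q s)) has_real_derivative \<Psi>' (Q s) * (2 * (1 + s))) (at s)"
    by (rule DERIV_chain2[OF \<Psi> Q])
  have T: "((\<lambda>s. a - Q s) has_real_derivative - (2 * (1 + s))) (at s)"
    using Q by (auto intro!: derivative_eq_intros)
  have root: "((\<lambda>s. sqrt (a - Q s)) has_real_derivative inverse (sqrt t) / 2 * - (2 * (1 + s))) (at s)"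
    unfolding t_def
    by (rule DERIV_chain2[where f = sqrt, OF DERIV_real_sqrt T]) (use t in \<open>simp add: t_def\<close>)
  have "(primitive a \<Psi> has_real_derivative
      - ((- (2 * (1 + s)) * sqrt t + inverse (sqrt t) / 2 * - (2 * (1 + s)) * t) * \<Psi> (Q s)
        + \<Psi>' (Q s) * (2 * (1 + s)) * (t * sqrt t))) (at s)"
    unfolding primitive_def[abs_def] t_def
    by (intro DERIV_minus DERIV_mult T root[unfolded t_def] \<Psi>Q)
  also have "inverse (sqrt t) / 2 * - (2 * (1 + s)) * t = - ((1 + s) * sqrt t)"
  proof -
    have "inverse (sqrt t) * t = sqrt t" using t by (simp add: field_simps)
    moreover have "inverse (sqrt t) / 2 * - (2 * (1 + s)) * t = - ((1 + s) * (inverse (sqrt t) * t))"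
      by (simp only: divide_inverse) (simp add: algebra_simps)
    ultimately show ?thesis by simp
  qed
  also have "- ((- (2 * (1 + s)) * sqrt t + - ((1 + s) * sqrt t)) * \<Psi> (Q s)
        + \<Psi>' (Q s) * (2 * (1 + s)) * (t * sqrt t))
      = 2 * (1 + s) * sqrt t * weight a \<Psi> \<Psi>' (Q s)"
    unfolding weight_def t_def[symmetric] by (simp add: algebra_simps)
  finally show ?thesis by (simp add: t_def)
qed

lemma continuous_on_primitive:
  assumes "continuous_on (Q ` S) \<Psi>"
  shows "continuous_on S (primitive a \<Psi>)"
  unfolding primitive_def[abs_def]
  by (intro continuous_intros continuous_on_Q continuous_on_compose2[OF assms]) auto

lemma primitive_deriv_square:
  "(2 * (1 + s) * sqrt (a - Q s) * w)\<^sup>2 = 4 * (a - Q s) * (w\<^sup>2 * (Q s - 1))" if "Q s \<le> a"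
proof -
  have "(2 * (1 + s) * sqrt (a - Q s) * w)\<^sup>2 = 4 * (1 + s)\<^sup>2 * (sqrt (a - Q s))\<^sup>2 * w\<^sup>2"
    by (simp only: power_mult_distrib) simp
  also have "(sqrt (a - Q s))\<^sup>2 = a - Q s" using that by simp
  also have "(1 + s)\<^sup>2 = Q s - 1" by (simp add: Q_eq_square)
  finally show ?thesis by (simp only: mult_ac)
qed

lemma g_eq_sqrt: "g s = sqrt (4 * (8 - P s) / (Q s ^ 4 * ((Q s)\<^sup>2 - 2)))"
proof -
  have "2 / (Q s)\<^sup>2 = sqrt (4 / Q s ^ 4)"
    by (rule real_sqrt_unique[symmetric]) (simp_all add: power_divide)
  then show ?thesis unfolding g_eq_Q by (simp flip: real_sqrt_mult)
qed

text \<open>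
If \<open>a\<close> is at most the root of the cubic, then
\<open>16 + 4 q\<^sup>2 - 3 q\<^sup>3 \<ge> (a - q) * cubic_quotient a q\<close> for \<open>q \<le> a\<close>. Squaring therefore reduces the
comparison of \<open>g\<close> with the derivative of the primitive to an inequality between rational
functions of \<open>q\<close>, free of the singular factor. The primitive vanishes at \<open>q = a\<close>, and \<open>g\<close> is
nonnegative on what is left of the range.
\<close>

lemma G_ge_primitive:
  assumes a: "2 < a" "3 * a ^ 3 - 4 * a\<^sup>2 \<le> 16"
    and \<Psi>: "\<And>q. 2 \<le> q \<Longrightarrow> q \<le> a \<Longrightarrow> (\<Psi> has_real_derivative \<Psi>' q) (at q)"
    and ineq: "\<And>q. 2 \<le> q \<Longrightarrow> q \<le> a \<Longrightarrow>
      (weight a \<Psi> \<Psi>' q)\<^sup>2 * radicand_denominator q \<le> cubic_quotient a q"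
  shows "(a - 2) * sqrt (a - 2) * \<Psi> 2 \<le> G v_plus"
proof -
  \<comment> \<open>The point of the range of integration at which \<open>q = a\<close>.\<close>
  define b where "b = sqrt (a - 1) - 1"
  have b: "0 < b" "Q b = a" using a(1) by (simp_all add: b_def Q_eq_square)
  have "P b \<le> 8" unfolding P_eq_Q b using a(2) by simp
  then have "b \<le> v_plus" using P_strict_mono[of v_plus b] v_plus_root by (cases "v_plus < b") auto
  have Q_mono: "2 \<le> Q s" "Q s < a" if "0 < s" "s < b" for s
  proof -
    show "2 \<le> Q s" using that by (intro Q_ge_2) simp
    have "(1 + s)\<^sup>2 < (1 + b)\<^sup>2" using that by (intro power_strict_mono) auto
    then show "Q s < a" unfolding b(2)[symmetric] Q_eq_square by simp
  qed
  have "G 0 - primitive a \<Psi> 0 \<le> G b - primitive a \<Psi> b"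
  proof (rule DERIV_nonneg_imp_increasing_open[of 0 b])
    fix s assume s: "0 < s" "s < b"
    note q = Q_mono[OF s]
    let ?d = "2 * (1 + s) * sqrt (a - Q s) * weight a \<Psi> \<Psi>' (Q s)"
    have "?d \<le> g s"
      unfolding g_eq_sqrt
    proof (rule real_le_rsqrt)
      have D: "0 < Q s ^ 4 * ((Q s)\<^sup>2 - 2)" using Q_pos[of s] Q_square_gt_2[of s] s by simp
      have "?d\<^sup>2 * (Q s ^ 4 * ((Q s)\<^sup>2 - 2))
          = 4 * (a - Q s) * ((weight a \<Psi> \<Psi>' (Q s))\<^sup>2 * radicand_denominator (Q s))"
        using q by (subst primitive_deriv_square) (simp_all add: radicand_denominator_def)
      also have "\<dots> \<le> 4 * (a - Q s) * cubic_quotient a (Q s)"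
        using q by (intro mult_left_mono ineq) auto
      also have "\<dots> \<le> 4 * (8 - P s)"
        unfolding mult.assoc cubic_quotient_eq P_eq_Q using a(2) by (simp add: algebra_simps)
      finally show "?d\<^sup>2 \<le> 4 * (8 - P s) / (Q s ^ 4 * ((Q s)\<^sup>2 - 2))"
        using D by (simp add: pos_le_divide_eq)
    qed
    moreover have "((\<lambda>s. G s - primitive a \<Psi> s) has_real_derivative g s - ?d) (at s)"
      using q by (intro DERIV_diff G_deriv s primitive_deriv \<Psi>) auto
    ultimately show "\<exists>y. ((\<lambda>s. G s - primitive a \<Psi> s) has_real_derivative y) (at s) \<and> 0 \<le> y"
      by (intro exI conjI) auto
  next
    have "Q s \<in> {2..a}" if "s \<in> {0..b}" for s
    proof -
      have "(1 + s)\<^sup>2 \<le> (1 + b)\<^sup>2" using that by (intro power_mono) auto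
      then show ?thesis using Q_ge_2[of s] that unfolding b(2)[symmetric] Q_eq_square by auto
    qed
    then have "continuous_on (Q ` {0..b}) \<Psi>"
      by (intro continuous_at_imp_continuous_on ballI) (auto intro!: DERIV_isCont[OF \<Psi>])
    then show "continuous_on {0..b} (\<lambda>s. G s - primitive a \<Psi> s)"
      by (intro continuous_intros continuous_on_G continuous_on_primitive)
  qed (use b in simp)
  moreover have "primitive a \<Psi> b = 0" unfolding primitive_def b(2) by simp
  moreover have "G b \<le> G v_plus"
    using G_strict_mono[of b v_plus] b \<open>b \<le> v_plus\<close> by (auto simp: order.order_iff_strict)
  moreover have "primitive a \<Psi> 0 = - ((a - 2) * sqrt (a - 2) * \<Psi> 2)"
    by (simp add: primitive_def Q_def)
  ultimately show ?thesis by (simp add: G_0)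
qed

text \<open>
The mirror image, with \<open>a\<close> at least the root of the cubic. Two signs enter: the squares can be
compared because \<open>weight\<close> is nonnegative, and the primitive, which no longer vanishes at \<open>v_plus\<close>,
is at most \<open>0\<close> there because \<open>\<Psi>\<close> is nonnegative.
\<close>

lemma G_le_primitive:
  assumes a: "2 < a" "16 \<le> 3 * a ^ 3 - 4 * a\<^sup>2"
    and \<Psi>: "\<And>q. 2 \<le> q \<Longrightarrow> q \<le> a \<Longrightarrow> (\<Psi> has_real_derivative \<Psi>' q) (at q)"
    and nonneg: "\<And>q. 2 \<le> q \<Longrightarrow> q \<le> a \<Longrightarrow> 0 \<le> \<Psi> q" "\<And>q. 2 \<le> q \<Longrightarrow> q \<le> a \<Longrightarrow> 0 \<le> weight a \<Psi> \<Psi>' q"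
    and ineq: "\<And>q. 2 \<le> q \<Longrightarrow> q \<le> a \<Longrightarrow>
      cubic_quotient a q \<le> (weight a \<Psi> \<Psi>' q)\<^sup>2 * radicand_denominator q"
  shows "G v_plus \<le> (a - 2) * sqrt (a - 2) * \<Psi> 2"
proof -
  define b where "b = v_plus"
  have b: "0 < b" using v_plus_root by (simp add: b_def)
  have "Q b \<le> a"
  proof (rule ccontr)
    define r where "r = sqrt (a - 1) - 1"
    have r: "0 < r" "Q r = a" using a(1) by (simp_all add: r_def Q_eq_square)
    assume "\<not> Q b \<le> a"
    then have "(1 + r)\<^sup>2 < (1 + b)\<^sup>2" unfolding r(2)[symmetric] Q_eq_square by simp
    then have "r < b" using power_less_imp_less_base[of "1 + r" 2 "1 + b"] b by simp
    then have "P r < 8" using P_strict_mono[of r b] r v_plus_root by (simp add: b_def)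
    then show False using a(2) unfolding P_eq_Q r by simp
  qed
  have Q_bounds: "2 \<le> Q s" "Q s \<le> a" if "0 \<le> s" "s \<le> b" for s
  proof -
    show "2 \<le> Q s" using that by (intro Q_ge_2) simp
    have "(1 + s)\<^sup>2 \<le> (1 + b)\<^sup>2" using that by (intro power_mono) auto
    then show "Q s \<le> a" using \<open>Q b \<le> a\<close> unfolding Q_eq_square by simp
  qed
  have "primitive a \<Psi> 0 - G 0 \<le> primitive a \<Psi> b - G b"
  proof (rule DERIV_nonneg_imp_increasing_open[of 0 b])
    fix s assume s: "0 < s" "s < b"
    have q: "2 \<le> Q s" "Q s < a"
    proof -
      show "2 \<le> Q s" using Q_bounds s by simp
      have "(1 + s)\<^sup>2 < (1 + b)\<^sup>2" using s by (intro power_strict_mono) auto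
      then show "Q s < a" using \<open>Q b \<le> a\<close> unfolding Q_eq_square by simp
    qed
    let ?d = "2 * (1 + s) * sqrt (a - Q s) * weight a \<Psi> \<Psi>' (Q s)"
    have "g s \<le> ?d"
      unfolding g_eq_sqrt
    proof (rule real_le_lsqrt)
      have D: "0 < Q s ^ 4 * ((Q s)\<^sup>2 - 2)" using Q_pos[of s] Q_square_gt_2[of s] s by simp
      have "4 * (8 - P s) \<le> 4 * (a - Q s) * cubic_quotient a (Q s)"
        unfolding mult.assoc cubic_quotient_eq P_eq_Q using a(2) by (simp add: algebra_simps)
      also have "\<dots> \<le> 4 * (a - Q s) * ((weight a \<Psi> \<Psi>' (Q s))\<^sup>2 * radicand_denominator (Q s))"
        using q by (intro mult_left_mono ineq) auto
      also have "\<dots> = ?d\<^sup>2 * (Q s ^ 4 * ((Q s)\<^sup>2 - 2))"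
        using q by (subst primitive_deriv_square) (simp_all add: radicand_denominator_def)
      finally show "4 * (8 - P s) / (Q s ^ 4 * ((Q s)\<^sup>2 - 2)) \<le> ?d\<^sup>2"
        using D by (simp add: pos_divide_le_eq)
      show "0 \<le> ?d" using s q nonneg(2) by (intro mult_nonneg_nonneg) auto
    qed
    moreover have "((\<lambda>s. primitive a \<Psi> s - G s) has_real_derivative ?d - g s) (at s)"
      using q by (intro DERIV_diff G_deriv s primitive_deriv \<Psi>) auto
    ultimately show "\<exists>y. ((\<lambda>s. primitive a \<Psi> s - G s) has_real_derivative y) (at s) \<and> 0 \<le> y"
      by (intro exI conjI) auto
  next
    have "continuous_on (Q ` {0..b}) \<Psi>"
      using Q_bounds by (intro continuous_at_imp_continuous_on ballI) (auto intro!: DERIV_isCont[OF \<Psi>])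
    then show "continuous_on {0..b} (\<lambda>s. primitive a \<Psi> s - G s)"
      by (intro continuous_intros continuous_on_G continuous_on_primitive)
  qed (use b in simp)
  moreover have "primitive a \<Psi> b \<le> 0"
    using Q_bounds[of b] b nonneg(1) by (simp add: primitive_def)
  moreover have "primitive a \<Psi> 0 = - ((a - 2) * sqrt (a - 2) * \<Psi> 2)"
    by (simp add: primitive_def Q_def)
  ultimately show ?thesis by (simp add: G_0 b_def)
qed

section \<open>Polynomials with integer coefficient lists\<close>

text \<open>
Coefficient lists, lowest order first, with integer entries: rational arithmetic would spend
its time on cancelling common factors.
\<close>

fun coeffs_add :: "int list \<Rightarrow> int list \<Rightarrow> int list" where
  "coeffs_add [] ys = ys"
| "coeffs_add xs [] = xs"
| "coeffs_add (x # xs) (y # ys) = (x + y) # coeffs_add xs ys"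

fun coeffs_mult :: "int list \<Rightarrow> int list \<Rightarrow> int list" where
  "coeffs_mult [] ys = []"
| "coeffs_mult (x # xs) ys = coeffs_add (map ((*) x) ys) (0 # coeffs_mult xs ys)"

fun coeffs_deriv :: "int list \<Rightarrow> int list" where
  "coeffs_deriv [] = []"
| "coeffs_deriv (x # xs) = coeffs_add xs (0 # coeffs_deriv xs)"

text \<open>
This suffices for nonnegativity on \<open>[-1, 1]\<close>, where each power of the variable is at most \<open>1\<close> in
absolute value.
\<close>

fun head_dominates :: "int list \<Rightarrow> bool" where
  "head_dominates [] = True"
| "head_dominates (x # xs) = (sum_list (map abs xs) \<le> x)"

abbreviation coeffs_eval :: "int list \<Rightarrow> real \<Rightarrow> real" where
  "coeffs_eval xs u \<equiv> horner_sum of_int u xs"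

lemma coeffs_eval_add: "coeffs_eval (coeffs_add xs ys) u = coeffs_eval xs u + coeffs_eval ys u"
  by (induction xs ys rule: coeffs_add.induct) (simp_all add: algebra_simps)

lemma coeffs_eval_scale: "coeffs_eval (map ((*) c) xs) u = of_int c * coeffs_eval xs u"
  by (induction xs) (simp_all add: algebra_simps)

lemma coeffs_eval_uminus: "coeffs_eval (map uminus xs) u = - coeffs_eval xs u"
  by (induction xs) (simp_all add: algebra_simps)

lemma coeffs_eval_mult: "coeffs_eval (coeffs_mult xs ys) u = coeffs_eval xs u * coeffs_eval ys u"
  by (induction xs) (simp_all add: coeffs_eval_add coeffs_eval_scale algebra_simps)

lemma coeffs_eval_deriv:
  "((\<lambda>u. coeffs_eval xs u) has_real_derivative coeffs_eval (coeffs_deriv xs) u) (at u)"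
proof (induction xs)
  case (Cons x xs)
  have "((\<lambda>u. of_int x + u * coeffs_eval xs u) has_real_derivative
      0 + (1 * coeffs_eval xs u + coeffs_eval (coeffs_deriv xs) u * u)) (at u)"
    by (intro DERIV_add DERIV_const DERIV_mult DERIV_ident Cons)
  then show ?case by (simp add: coeffs_eval_add mult.commute)
qed simp

lemma abs_coeffs_eval_le:
  assumes "\<bar>u\<bar> \<le> 1"
  shows "\<bar>coeffs_eval xs u\<bar> \<le> of_int (sum_list (map abs xs))"
proof (induction xs)
  case (Cons x xs)
  have "\<bar>u * coeffs_eval xs u\<bar> \<le> 1 * of_int (sum_list (map abs xs))"
    unfolding abs_mult using assms Cons by (intro mult_mono) auto
  then show ?case by simp
qed simp

lemma head_dominates_nonneg:
  assumes "\<bar>u\<bar> \<le> 1" "head_dominates xs"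
  shows "0 \<le> coeffs_eval xs u"
proof (cases xs)
  case (Cons y ys)
  have "\<bar>u * coeffs_eval ys u\<bar> \<le> 1 * of_int (sum_list (map abs ys))"
    unfolding abs_mult using assms abs_coeffs_eval_le[OF assms(1)] by (intro mult_mono) auto
  also have "\<dots> \<le> of_int y" using assms(2) Cons by simp
  finally show ?thesis using Cons by simp
qed simp

section \<open>Certified numerical bounds\<close>

text \<open>
All lists below are in the variable \<open>u = (80 q - 173) / 13\<close>, for which \<open>u = -1\<close> at \<open>q = 2\<close> and \<open>u = 1\<close>
at \<open>q = 93/40\<close>, a little beyond the root of the cubic. The end point is \<open>a = A / 10 ^ 18\<close>, and
\<open>\<Psi>\<close> has the coefficients \<open>K / 10 ^ 19\<close>. The remaining factors clear denominators; they are made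
explicit by the evaluation lemmas \<open>weight_ansatz\<close>, \<open>denominator_coeffs_eval\<close>,
\<open>quotient_coeffs_eval\<close> and \<open>residual_coeffs_eval\<close>.
\<close>

definition weight_coeffs :: "int \<Rightarrow> int list \<Rightarrow> int list" where
  "weight_coeffs A K = coeffs_add (map ((*) (39 * 10 ^ 18)) K)
     (coeffs_mult [2 * (173 * 10 ^ 18 - 80 * A), 26 * 10 ^ 18] (coeffs_deriv K))"

definition denominator_coeffs :: "int list" where
  "denominator_coeffs = (let q = [173, 13]; q2 = coeffs_mult q q in
     coeffs_mult (coeffs_mult (coeffs_mult q2 q2) (coeffs_add q2 [-12800])) (coeffs_add q [-80]))"

definition quotient_coeffs :: "int \<Rightarrow> int list" where
  "quotient_coeffs A = (let q = [173 * 10 ^ 18, 13 * 10 ^ 18] in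
     coeffs_add
       (map ((*) 3) (coeffs_add (coeffs_mult q q) (coeffs_add (map ((*) (80 * A)) q) [(80 * A)\<^sup>2])))
       (map ((*) (- 320 * 10 ^ 18)) (coeffs_add q [80 * A])))"

definition residual_coeffs :: "int \<Rightarrow> int list \<Rightarrow> int list" where
  "residual_coeffs A K = coeffs_add (map ((*) ((26 * 10 ^ 19)\<^sup>2 * 80 ^ 5)) (quotient_coeffs A))
     (map uminus (coeffs_mult (coeffs_mult (weight_coeffs A K) (weight_coeffs A K)) denominator_coeffs))"

text \<open>
The end points are the root \<open>2.32227593329631861640...\<close> of \<open>3 q\<^sup>3 - 4 q\<^sup>2 = 16\<close>, rounded down and up to
18 decimals. For the coefficients, the square root of \<open>cubic_quotient a q / radicand_denominator q\<close> is
expanded in powers of \<open>u\<close> up to degree 24 and multiplied by \<open>1 - 1.1 * 10^-16\<close> for the lower bound and by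
\<open>1 + 4 * 10^-16\<close> for the upper one, to leave room for the truncation error; then \<open>\<Psi>\<close> is determined
from the top degree downwards such that \<open>weight\<close> has these coefficients. The nearest singularity of
the square root, at \<open>q = sqrt 2\<close>, corresponds to \<open>u\<close> near \<open>-4.6\<close>, and \<open>4.6 powr 24\<close> is about \<open>10 ^ 16\<close>.
\<close>

definition lower_end :: int where
  "lower_end = 2322275933296318616"

definition lower_coeffs :: "int list" where
  "lower_coeffs =
    [3776481311835489110, -685065670498173174, 109217990865430174, -17121095813828089,
     2723580905611168, -444644633445260, 74719710913838, -12911240886766, 2287737862517,
     -414293780186, 76431100795, -14323294328, 2719992408, -522356789, 101279845, -19799229,
     3898194, -772277, 153836, -30790, 6192, -1247, 255, -49, 13]"

definition upper_end :: int where
  "upper_end = 2322275933296318617"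

definition upper_coeffs :: "int list" where
  "upper_coeffs =
    [3776481311835491035, -685065670498173522, 109217990865430230, -17121095813828098,
     2723580905611169, -444644633445260, 74719710913838, -12911240886766, 2287737862517,
     -414293780186, 76431100795, -14323294328, 2719992408, -522356789, 101279845, -19799229,
     3898194, -772277, 153836, -30790, 6192, -1247, 255, -49, 13]"


definition ansatz :: "int list \<Rightarrow> real \<Rightarrow> real" where
  "ansatz K q = coeffs_eval K ((80 * q - 173) / 13) / 10 ^ 19"

definition ansatz_deriv :: "int list \<Rightarrow> real \<Rightarrow> real" where
  "ansatz_deriv K q = 80 / 13 * coeffs_eval (coeffs_deriv K) ((80 * q - 173) / 13) / 10 ^ 19"

lemma ansatz_deriv: "(ansatz K has_real_derivative ansatz_deriv K q) (at q)"
proof -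
  have "((\<lambda>q. (80 * q - 173) / 13 :: real) has_real_derivative 80 / 13) (at q)"
    by (auto intro!: derivative_eq_intros)
  from DERIV_cdivide[OF DERIV_chain2[OF coeffs_eval_deriv this], of K "10 ^ 19"]
  show ?thesis by (simp add: ansatz_def[abs_def] ansatz_deriv_def mult.commute)
qed

lemma weight_ansatz:
  "26 * 10 ^ 37 * weight (of_int A / 10 ^ 18) (ansatz K) (ansatz_deriv K) q
    = coeffs_eval (weight_coeffs A K) ((80 * q - 173) / 13)"
proof -
  define u where "u = (80 * q - 173) / 13"
  have q: "q = (173 + 13 * u) / 80" by (simp add: u_def field_simps)
  show ?thesis
    unfolding weight_def ansatz_def ansatz_deriv_def weight_coeffs_def u_def[symmetric]
      coeffs_eval_add coeffs_eval_mult coeffs_eval_scale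
    by (simp add: q field_simps)
qed

lemma denominator_coeffs_eval:
  "coeffs_eval denominator_coeffs ((80 * q - 173) / 13) = 80 ^ 7 * radicand_denominator q"
proof -
  define u where "u = (80 * q - 173) / 13"
  have e: "coeffs_eval [173, 13] u = 80 * q" by (simp add: u_def field_simps)
  show ?thesis
    unfolding denominator_coeffs_def Let_def coeffs_eval_add coeffs_eval_mult u_def[symmetric] e
      radicand_denominator_def
    by (simp add: algebra_simps power2_eq_square power4_eq_xxxx)
qed

lemma quotient_coeffs_eval:
  "coeffs_eval (quotient_coeffs A) ((80 * q - 173) / 13)
    = (80 * 10 ^ 18)\<^sup>2 * cubic_quotient (of_int A / 10 ^ 18) q"
proof -
  define u where "u = (80 * q - 173) / 13"
  have e: "coeffs_eval [173 * 10 ^ 18, 13 * 10 ^ 18] u = 80 * 10 ^ 18 * q" by (simp add: u_def field_simps)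
  show ?thesis
    unfolding quotient_coeffs_def Let_def coeffs_eval_add coeffs_eval_mult coeffs_eval_scale
      u_def[symmetric] e cubic_quotient_def
    by (simp add: field_simps power2_eq_square)
qed

text \<open>
The residual is the gap in the inequality between \<open>weight\<close> and \<open>cubic_quotient\<close>. Its coefficients
below degree 25 nearly cancel, apart from the safety margin put into \<open>K\<close>, and the later ones are
tiny, so that its sign is visible from the coefficients alone.
\<close>

lemma residual_coeffs_eval:
  "coeffs_eval (residual_coeffs A K) ((80 * q - 173) / 13)
    = (26 * 10 ^ 37)\<^sup>2 * 80 ^ 7 * (cubic_quotient (of_int A / 10 ^ 18) q
        - (weight (of_int A / 10 ^ 18) (ansatz K) (ansatz_deriv K) q)\<^sup>2 * radicand_denominator q)"
  (is "?lhs = ?c * (?C - ?w\<^sup>2 * ?D)")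
proof -
  have "?lhs = (26 * 10 ^ 19)\<^sup>2 * 80 ^ 5 * ((80 * 10 ^ 18)\<^sup>2 * ?C)
      - (26 * 10 ^ 37 * ?w)\<^sup>2 * (80 ^ 7 * ?D)"
    unfolding residual_coeffs_def coeffs_eval_add coeffs_eval_scale coeffs_eval_uminus
      coeffs_eval_mult quotient_coeffs_eval denominator_coeffs_eval weight_ansatz
    by (simp add: power2_eq_square)
  also have "(26 * 10 ^ 37 * ?w)\<^sup>2 = (26 * 10 ^ 37)\<^sup>2 * ?w\<^sup>2" by (rule power_mult_distrib)
  finally show ?thesis by (simp add: algebra_simps)
qed

lemma head_dominates_on_interval:
  assumes "head_dominates xs" "2 \<le> q" "q \<le> 93 / 40"
  shows "0 \<le> coeffs_eval xs ((80 * q - 173) / 13)"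
  by (rule head_dominates_nonneg) (use assms in \<open>auto simp: abs_le_iff field_simps\<close>)

text \<open>
The point \<open>q = 2\<close> is the start \<open>s = 0\<close> of the range of integration, where \<open>u = -1\<close>.
\<close>

lemma ansatz_2: "ansatz K 2 = of_int (horner_sum id (-1) K) / 10 ^ 19"
proof -
  have "coeffs_eval K (-1) = of_int (horner_sum id (-1) K)" by (induction K) auto
  then show ?thesis by (simp add: ansatz_def)
qed

lemma lower_check:
  "head_dominates (residual_coeffs lower_end lower_coeffs)"
  by code_simp

lemma upper_check:
  "head_dominates (map uminus (residual_coeffs upper_end upper_coeffs))"
  by code_simp

lemma endpoint_checks:
  "head_dominates upper_coeffs" "head_dominates (weight_coeffs upper_end upper_coeffs)"
  "2 * 10 ^ 18 < lower_end" "lower_end \<le> 2325 * 10 ^ 15"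
  "3 * lower_end ^ 3 - 4 * lower_end\<^sup>2 * 10 ^ 18 \<le> 16 * 10 ^ 54"
  "2 * 10 ^ 18 < upper_end" "upper_end \<le> 2325 * 10 ^ 15"
  "16 * 10 ^ 54 \<le> 3 * upper_end ^ 3 - 4 * upper_end\<^sup>2 * 10 ^ 18"
  "0 \<le> horner_sum id (-1) lower_coeffs" "0 \<le> horner_sum id (-1) upper_coeffs"
  by code_simp+

lemma primitive_value_checks:
  "(8399681039393785 * 10 ^ 29)\<^sup>2 \<le> (lower_end - 2 * 10 ^ 18) ^ 3 * (horner_sum id (-1) lower_coeffs)\<^sup>2"
  "(upper_end - 2 * 10 ^ 18) ^ 3 * (horner_sum id (-1) upper_coeffs)\<^sup>2 \<le> (8399681039393795 * 10 ^ 29)\<^sup>2"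
  by code_simp+

text \<open>
Squaring removes the square root of \<open>a - 2\<close> and leaves integers to compare.
\<close>

lemma primitive_square_2:
  fixes A :: int
  defines "a \<equiv> of_int A / 10 ^ 18"
  assumes "2 * 10 ^ 18 < A"
  shows "((a - 2) * sqrt (a - 2) * ansatz K 2)\<^sup>2
    = of_int ((A - 2 * 10 ^ 18) ^ 3 * (horner_sum id (-1) K)\<^sup>2) / 10 ^ 92"
proof -
  have "real_of_int (2 * 10 ^ 18) < of_int A" using assms(2) by (simp only: of_int_less_iff)
  then have T: "0 \<le> a - 2" by (simp add: a_def)
  have a2: "a - 2 = of_int (A - 2 * 10 ^ 18) / 10 ^ 18" by (simp add: a_def)
  have T3: "(a - 2) ^ 3 = of_int ((A - 2 * 10 ^ 18) ^ 3) / 10 ^ 54" unfolding a2 power_divide by simp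
  have "((a - 2) * sqrt (a - 2) * ansatz K 2)\<^sup>2 = (a - 2) ^ 3 * (ansatz K 2)\<^sup>2"
    using T by (simp add: power_mult_distrib power2_eq_square power3_eq_cube)
  also have "\<dots> = of_int ((A - 2 * 10 ^ 18) ^ 3 * (horner_sum id (-1) K)\<^sup>2) / 10 ^ 92"
    unfolding T3 ansatz_2 by (simp add: power_divide)
  finally show ?thesis .
qed

lemma endpoint_cubic:
  fixes A :: int
  defines "a \<equiv> of_int A / 10 ^ 18 :: real"
  shows "3 * a ^ 3 - 4 * a\<^sup>2 = of_int (3 * A ^ 3 - 4 * A\<^sup>2 * 10 ^ 18) / 10 ^ 54"
  by (simp add: a_def power_divide diff_divide_distrib)

lemma endpoint_bounds:
  fixes A :: int
  assumes "2 * 10 ^ 18 < A" "A \<le> 2325 * 10 ^ 15"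
  shows "2 < (of_int A / 10 ^ 18 :: real)" "(of_int A / 10 ^ 18 :: real) \<le> 93 / 40"
proof -
  have "real_of_int (2 * 10 ^ 18) < of_int A" "real_of_int A \<le> of_int (2325 * 10 ^ 15)"
    using assms by (simp_all only: of_int_less_iff of_int_le_iff)
  then show "2 < (of_int A / 10 ^ 18 :: real)" "(of_int A / 10 ^ 18 :: real) \<le> 93 / 40"
    by simp_all
qed

lemma G_v_plus_ge: "0.08399681039393785 \<le> G v_plus"
proof -
  define a :: real where "a = of_int lower_end / 10 ^ 18"
  note a = endpoint_bounds[OF endpoint_checks(3,4), folded a_def]
  have "real_of_int (3 * lower_end ^ 3 - 4 * lower_end\<^sup>2 * 10 ^ 18) \<le> of_int (16 * 10 ^ 54)"
    using endpoint_checks(5) by (simp only: of_int_le_iff)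
  then have cubic: "3 * a ^ 3 - 4 * a\<^sup>2 \<le> 16"
    unfolding a_def endpoint_cubic by (simp add: pos_divide_le_eq)
  have "(a - 2) * sqrt (a - 2) * ansatz lower_coeffs 2 \<le> G v_plus"
  proof (rule G_ge_primitive[OF a(1) cubic ansatz_deriv])
    fix q assume q: "2 \<le> q" "q \<le> a"
    then have "0 \<le> coeffs_eval (residual_coeffs lower_end lower_coeffs) ((80 * q - 173) / 13)"
      using a(2) by (intro head_dominates_on_interval lower_check) auto
    then show "(weight a (ansatz lower_coeffs) (ansatz_deriv lower_coeffs) q)\<^sup>2 * radicand_denominator q
        \<le> cubic_quotient a q"
      unfolding residual_coeffs_eval a_def by (simp add: zero_le_mult_iff)
  qed
  moreover have "0.08399681039393785 \<le> (a - 2) * sqrt (a - 2) * ansatz lower_coeffs 2"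
  proof (rule power2_le_imp_le)
    have "real_of_int ((8399681039393785 * 10 ^ 29)\<^sup>2)
        \<le> of_int ((lower_end - 2 * 10 ^ 18) ^ 3 * (horner_sum id (-1) lower_coeffs)\<^sup>2)"
      using primitive_value_checks(1) by (simp only: of_int_le_iff)
    then show "0.08399681039393785\<^sup>2 \<le> ((a - 2) * sqrt (a - 2) * ansatz lower_coeffs 2)\<^sup>2"
      unfolding a_def primitive_square_2[OF endpoint_checks(3)]
      by (subst pos_le_divide_eq) (simp_all add: power_divide)
    show "0 \<le> (a - 2) * sqrt (a - 2) * ansatz lower_coeffs 2"
      using a(1) endpoint_checks(9) by (simp add: ansatz_2)
  qed
  ultimately show ?thesis by linarith
qed

lemma G_v_plus_le: "G v_plus \<le> 0.08399681039393795"
proof -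
  define a :: real where "a = of_int upper_end / 10 ^ 18"
  note a = endpoint_bounds[OF endpoint_checks(6,7), folded a_def]
  have "real_of_int (16 * 10 ^ 54) \<le> of_int (3 * upper_end ^ 3 - 4 * upper_end\<^sup>2 * 10 ^ 18)"
    using endpoint_checks(8) by (simp only: of_int_le_iff)
  then have cubic: "16 \<le> 3 * a ^ 3 - 4 * a\<^sup>2"
    unfolding a_def endpoint_cubic by (simp add: pos_le_divide_eq)
  have "G v_plus \<le> (a - 2) * sqrt (a - 2) * ansatz upper_coeffs 2"
  proof (rule G_le_primitive[OF a(1) cubic ansatz_deriv])
    fix q assume q: "2 \<le> q" "q \<le> a"
    then have q': "q \<le> 93 / 40" using a(2) by simp
    show "0 \<le> ansatz upper_coeffs q"
      using head_dominates_on_interval[OF endpoint_checks(1) q(1) q'] by (simp add: ansatz_def)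
    show "0 \<le> weight a (ansatz upper_coeffs) (ansatz_deriv upper_coeffs) q"
      using head_dominates_on_interval[OF endpoint_checks(2) q(1) q', folded weight_ansatz]
      by (simp add: a_def zero_le_mult_iff)
    show "cubic_quotient a q
        \<le> (weight a (ansatz upper_coeffs) (ansatz_deriv upper_coeffs) q)\<^sup>2 * radicand_denominator q"
      using head_dominates_on_interval[OF upper_check q(1) q']
      unfolding coeffs_eval_uminus residual_coeffs_eval a_def by (simp add: mult_le_0_iff)
  qed
  moreover have "(a - 2) * sqrt (a - 2) * ansatz upper_coeffs 2 \<le> 0.08399681039393795"
  proof (rule power2_le_imp_le)
    have "real_of_int ((upper_end - 2 * 10 ^ 18) ^ 3 * (horner_sum id (-1) upper_coeffs)\<^sup>2)
        \<le> of_int ((8399681039393795 * 10 ^ 29)\<^sup>2)"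
      using primitive_value_checks(2) by (simp only: of_int_le_iff)
    then show "((a - 2) * sqrt (a - 2) * ansatz upper_coeffs 2)\<^sup>2 \<le> 0.08399681039393795\<^sup>2"
      unfolding a_def primitive_square_2[OF endpoint_checks(6)]
      by (subst pos_divide_le_eq) (simp_all add: power_divide)
  qed simp
  ultimately show ?thesis by linarith
qed

lemma v_plus_bounds: "0.1499025755673035 \<le> v_plus" "v_plus \<le> 0.1499025755673045"
proof -
  have lower: "P 0.1499025755673035 < (8 :: real)" and upper: "(8 :: real) < P 0.1499025755673045"
    by (simp_all add: P_def power_divide)
  show "0.1499025755673035 \<le> v_plus"
    using P_mono[of v_plus "0.1499025755673035"] lower v_plus_root
    by (metis less_imp_le linorder_not_le)
  show "v_plus \<le> 0.1499025755673045"
  proof (rule ccontr)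
    assume "\<not> ?thesis"
    then have "P 0.1499025755673045 < P v_plus" by (intro P_strict_mono) auto
    then show False using upper unfolding v_plus_root(2) by simp
  qed
qed

theorem proposition4:
  fixes c :: "nat \<Rightarrow> real \<times> real"
  assumes "power_series_solution c"
  shows "g integrable_on {0..v_plus}
    \<and> conv_radius c = ereal (integral {0..v_plus} g)
    \<and> \<bar>integral {0..v_plus} g - 0.0839968103939379\<bar> \<le> 5 / 10 ^ 17
    \<and> \<bar>v_plus - 0.149902575567304\<bar> \<le> 5 / 10 ^ 16"
proof (intro conjI)
  show "g integrable_on {0..v_plus}"
    by (intro integrable_continuous_real continuous_on_subset[OF continuous_on_g]) auto
  show "conv_radius c = ereal (integral {0..v_plus} g)"
    using conv_radius_eq_G[OF assms] by (simp add: G_def)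
  show "\<bar>integral {0..v_plus} g - 0.0839968103939379\<bar> \<le> 5 / 10 ^ 17"
    using G_v_plus_ge G_v_plus_le unfolding G_def by (intro abs_leI) simp_all
  show "\<bar>v_plus - 0.149902575567304\<bar> \<le> 5 / 10 ^ 16"
    using v_plus_bounds by (intro abs_leI) simp_all
qed

end
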